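(* Suppose assumptions (A) and (B) of the context hold, $\gamma\in\left(0,\frac{1}{2\rho_{f_2}+2\rho_{g_2}}\right)$, $c_k=\underline{c}\,(k+1)^p$ with $p\in[0,1/2)$ and $\underline{c}>0$, and $\eta_k\in\left[\underline{\eta},\frac{1/\gamma-\rho_{f_2}}{(L_f+1/\gamma)^2}\right]\cap\left[\underline{\eta},\frac{1}{\rho_{g_2}}\right)$ with $\underline{\eta}>0$. Then there exist $c_\alpha,c_\beta>0$ such that when $\alpha_k\in(\underline{\alpha},c_\alpha)$ and $\beta_k\in(\underline{\beta},c_\beta)$ with $\underline{\alpha},\underline{\beta}>0$, the sequence $(x^k,y^k,\theta^k)$ generated by the algorithm MEHA satisfies $$\min_{0\le k\le K}\left\|\theta^k-\theta_\gamma^*(x^k,y^k)\right\|=O\left(\frac{1}{K^{1/2}}\right)$$ and $$\min_{0\le k\le K}R_k(x^{k+1},y^{k+1})=O\left(\frac{1}{K^{(1-2p)/2}}\right).$$ Furthermore, if $p\in(0,1/2)$ and the sequence $\psi_{c_k}(x^k,y^k)$ is upper-bounded, then the sequence $(x^k,y^k)$ satisfies $$\varphi(x^K,y^K)-v_\gamma(x^K,y^K)=O\left(\frac{1}{K^p}\right).$$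
   Context: Setting. $X\subseteq\mathbb{R}^n$ and $Y\subseteq\mathbb{R}^m$ are closed convex sets; $F,f,g:\mathbb{R}^n\times\mathbb{R}^m\to\mathbb{R}$; $\varphi:=f+g$; $\delta_Y$ is the indicator function of $Y$ ($0$ on $Y$, $+\infty$ off $Y$) and $\tilde g(x,y):=g(x,y)+\delta_Y(y)$. A function $h$ is $L$-smooth on $X\times Y$ if it is continuously differentiable and $\nabla h$ is $L$-Lipschitz on $X\times Y$. A function $h(x,y)$ is $(\rho_1,\rho_2)$-weakly convex on $X\times Y$ if $h(x,y)+\frac{\rho_1}{2}\|x\|^2+\frac{\rho_2}{2}\|y\|^2$ is convex on $X\times Y$. For $h:\mathbb{R}^m\to\mathbb{R}\cup\{\infty\}$, $\mathrm{Prox}_h(y):=\arg\min_{\theta\in\mathbb{R}^m}\{h(\theta)+\|\theta-y\|^2/2\}$. $\mathrm{Proj}_X$ is the Euclidean projection onto $X$. Assumptions. (A) $\underline F:=\inf_{X\times Y}F>-\infty$; $F$ is $L_F$-smooth on $X\times Y$; $f$ is $L_f$-smooth on $X\times Y$. Consequently $f$ is $(\rho_{f_1},\rho_{f_2})$-weakly convex on $X\times Y$ with $\rho_{f_1}=\rho_{f_2}=L_f$. (B) One of the following holds: (i) $g(x,y)=\hat g(y)$ with $\hat g$ weakly convex on $Y$; (ii) $g(x,y)=x\|y\|_1$, $X=\mathbb{R}_+$, $Y=\mathbb{R}^m$; (iii) $g(x,y)=\sum_{j=1}^J x_j\|y^{(j)}\|_2$, where $\{1,\dots,m\}$ is divided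 into $J$ groups, $y^{(j)}$ is the $j$-th group of $y$, $X=\mathbb{R}^J_+$, $Y=\mathbb{R}^m$; (iv) $g$ is $(\rho_{g_1},\rho_{g_2})$-weakly convex on $X\times Y$, $\nabla_xg(x,y)$ exists and is $L_g$-Lipschitz on $X\times Y$, and there are positive constants $L_{\tilde g},\bar s$ such that $\|\mathrm{Prox}_{s\tilde g(x,\cdot)}(\theta)-\mathrm{Prox}_{s\tilde g(x',\cdot)}(\theta)\|\le L_{\tilde g}\|x-x'\|$ for all $x,x'\in X$, $\theta\in Y$, $s\in(0,\bar s]$. Cases (i)–(iii) are special cases of (iv), and $\rho_{g_1},\rho_{g_2},L_g$ denote the constants in (iv). Moreau envelope. $v_\gamma(x,y):=\inf_{\theta\in Y}\{\varphi(x,\theta)+\frac{1}{2\gamma}\|\theta-y\|^2\}$, and $\theta_\gamma^*(x,y)$ denotes the unique minimizer in this problem. The gradient of $v_\gamma$ is $$\nabla v_\gamma(x,y)=\big(\nabla_xf(x,\theta_\gamma^*(x,y))+\nabla_xg(x,\theta_\gamma^*(x,y)),\ (y-\theta_\gamma^*(x,y))/\gamma\big).$$ $\psi_{c_k}(x,y):=F(x,y)+c_k(\varphi(x,y)-v_\gamma(x,y))$. Residual. $$R_k(x,y):=\mathrm{dist}\Big(0,\ \nabla F(x,y)+c_k\big(\nabla f(x,y)+\partial g(x,y)-\nabla v_\gamma(x,y)\big)+\mathcal N_{X\times Y}(x,y)\Big),$$ where $\partial$ is the Fréchet (regular) subdifferential and $\mathcal N_{X\times Y}$ the normal cone to $X\times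 Y$. Algorithm MEHA. Initialize $x^0,y^0,\theta^0$; with stepsizes $\alpha_k,\beta_k,\eta_k$, proximal parameter $\gamma$ and penalty parameters $c_k$, for $k=0,1,2,\dots$: $$\theta^{k+1}=\mathrm{Prox}_{\eta_k\tilde g(x^k,\cdot)}\Big(\theta^k-\eta_k\big(\nabla_yf(x^k,\theta^k)+\tfrac1\gamma(\theta^k-y^k)\big)\Big),$$ $$d_x^k=\tfrac1{c_k}\nabla_xF(x^k,y^k)+\nabla_xf(x^k,y^k)+\nabla_xg(x^k,y^k)-\nabla_xf(x^k,\theta^{k+1})-\nabla_xg(x^k,\theta^{k+1}),\quad x^{k+1}=\mathrm{Proj}_X(x^k-\alpha_kd_x^k),$$ $$d_y^k=\tfrac1{c_k}\nabla_yF(x^{k+1},y^k)+\nabla_yf(x^{k+1},y^k)-\tfrac1\gamma(y^k-\theta^{k+1}),\quad y^{k+1}=\mathrm{Prox}_{\beta_k\tilde g(x^{k+1},\cdot)}(y^k-\beta_kd_y^k).$$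
   Formalization: In R_k the subdifferential of g is taken relative to X×Y (that of g plus the indicator of X×Y), since with the full-space ∂g the bound fails when g is badly behaved off X×Y; existence of the minimizer θ*_γ(x,y) on X×Y is assumed explicitly. *)

theory Defs
  imports "HOL-Analysis.Analysis" "HOL-Library.Landau_Symbols"
begin

text \<open>
  Functions of two variables are functions on the product space. Gradients are taken in the whole
  space (\<open>GDERIV\<close> uses the filter \<open>at x\<close>), hence are unique where they exist;
  \<open>gradient h x\<close> is meaningful only there.
\<close>

definition gradient :: "('a::real_inner \<Rightarrow> real) \<Rightarrow> 'a \<Rightarrow> 'a" where
  "gradient h x = (THE D. GDERIV h x :> D)"

definition gradient_x :: "('a::real_inner \<times> 'b::real_inner \<Rightarrow> real) \<Rightarrow> 'a \<Rightarrow> 'b \<Rightarrow> 'a" where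
  "gradient_x h x y = gradient (\<lambda>u. h (u, y)) x"

definition gradient_y :: "('a::real_inner \<times> 'b::real_inner \<Rightarrow> real) \<Rightarrow> 'a \<Rightarrow> 'b \<Rightarrow> 'b" where
  "gradient_y h x y = gradient (\<lambda>v. h (x, v)) y"

lemma gradient_eqI:
  assumes "GDERIV h x :> D"
  shows "gradient h x = D"
  unfolding gradient_def
proof (rule the_equality[where P = "\<lambda>D. GDERIV h x :> D", OF assms])
  fix D' assume "GDERIV h x :> D'"
  then have "(\<lambda>u. inner u D') = (\<lambda>u. inner u D)"
    using assms has_derivative_unique unfolding gderiv_def by blast
  then have "inner (D' - D) D' = inner (D' - D) D" by metis
  then have "inner (D' - D) (D' - D) = 0" by (simp add: inner_diff_right)
  then show "D' = D" by simp
qed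

text \<open>Continuity of the gradient on \<open>S\<close> is part of its Lipschitz continuity.\<close>

definition smooth_on_with :: "real \<Rightarrow> 'a::real_inner set \<Rightarrow> ('a \<Rightarrow> real) \<Rightarrow> bool" where
  "smooth_on_with L S h \<longleftrightarrow> (\<forall>z\<in>S. \<exists>D. GDERIV h z :> D) \<and> L-lipschitz_on S (gradient h)"

definition weakly_convex_on :: "real \<Rightarrow> 'a::real_inner set \<Rightarrow> ('a \<Rightarrow> real) \<Rightarrow> bool" where
  "weakly_convex_on \<rho> S h \<longleftrightarrow> convex_on S (\<lambda>x. h x + \<rho> / 2 * (norm x)\<^sup>2)"

definition weakly_convex2_on ::
    "real \<Rightarrow> real \<Rightarrow> ('a::real_inner \<times> 'b::real_inner) set \<Rightarrow> ('a \<times> 'b \<Rightarrow> real) \<Rightarrow> bool" where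
  "weakly_convex2_on \<rho>1 \<rho>2 S h \<longleftrightarrow>
     convex_on S (\<lambda>(x, y). h (x, y) + \<rho>1 / 2 * (norm x)\<^sup>2 + \<rho>2 / 2 * (norm y)\<^sup>2)"

definition indicator_ereal :: "'a set \<Rightarrow> 'a \<Rightarrow> ereal" where
  "indicator_ereal S x = (if x \<in> S then 0 else \<infinity>)"

text \<open>The proximal map is the set of minimizers; a minimizer need neither exist nor be unique.\<close>

definition prox :: "('b::real_normed_vector \<Rightarrow> ereal) \<Rightarrow> 'b \<Rightarrow> 'b set" where
  "prox h y = {t. is_arg_min (\<lambda>t. h t + ereal ((norm (t - y))\<^sup>2 / 2)) (\<lambda>_. True) t}"

definition g_tilde :: "'b set \<Rightarrow> ('a \<times> 'b \<Rightarrow> real) \<Rightarrow> 'a \<Rightarrow> 'b \<Rightarrow> ereal" where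
  "g_tilde Y g x y = ereal (g (x, y)) + indicator_ereal Y y"

definition prox_g_tilde ::
    "'b::real_normed_vector set \<Rightarrow> ('a \<times> 'b \<Rightarrow> real) \<Rightarrow> real \<Rightarrow> 'a \<Rightarrow> 'b \<Rightarrow> 'b set" where
  "prox_g_tilde Y g s x = prox (\<lambda>t. ereal s * g_tilde Y g x t)"

definition g_case_i :: "'b::real_inner set \<Rightarrow> ('a \<times> 'b \<Rightarrow> real) \<Rightarrow> bool" where
  "g_case_i Y g \<longleftrightarrow>
     (\<exists>ghat \<rho>. 0 \<le> \<rho> \<and> weakly_convex_on \<rho> Y ghat \<and> (\<forall>x y. g (x, y) = ghat y))"

text \<open>Here the first factor is one-dimensional, so that \<open>x $ i\<close> does not depend on \<open>i\<close>.\<close>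

definition g_case_ii ::
    "(real^'n) set \<Rightarrow> (real^'m) set \<Rightarrow> ((real^'n) \<times> (real^'m) \<Rightarrow> real) \<Rightarrow> bool" where
  "g_case_ii X Y g \<longleftrightarrow> CARD('n) = 1 \<and> X = {x. \<forall>i. 0 \<le> x $ i} \<and> Y = UNIV \<and>
     (\<forall>x y i. g (x, y) = x $ i * (\<Sum>j\<in>UNIV. \<bar>y $ j\<bar>))"

text \<open>The groups are indexed by \<open>'n\<close>; \<open>grp i\<close> is the group containing the coordinate \<open>i\<close>.\<close>

definition g_case_iii ::
    "(real^'n) set \<Rightarrow> (real^'m) set \<Rightarrow> ((real^'n) \<times> (real^'m) \<Rightarrow> real) \<Rightarrow> bool" where
  "g_case_iii X Y g \<longleftrightarrow> X = {x. \<forall>j. 0 \<le> x $ j} \<and> Y = UNIV \<and>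
     (\<exists>grp :: 'm \<Rightarrow> 'n. \<forall>x y. g (x, y) = (\<Sum>j\<in>UNIV. x $ j * L2_set (\<lambda>i. y $ i) {i. grp i = j}))"

definition regular_constants ::
    "'a::real_inner set \<Rightarrow> 'b::real_inner set \<Rightarrow> ('a \<times> 'b \<Rightarrow> real) \<Rightarrow> real \<Rightarrow> real \<Rightarrow> real \<Rightarrow> bool" where
  "regular_constants X Y g \<rho>1 \<rho>2 L \<longleftrightarrow>
     0 \<le> \<rho>1 \<and> 0 \<le> \<rho>2 \<and> weakly_convex2_on \<rho>1 \<rho>2 (X \<times> Y) g \<and>
     (\<forall>x\<in>X. \<forall>y\<in>Y. \<exists>D. GDERIV (\<lambda>u. g (u, y)) x :> D) \<and>
     L-lipschitz_on (X \<times> Y) (\<lambda>(x, y). gradient_x g x y)"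

definition prox_lipschitz ::
    "'a::real_normed_vector set \<Rightarrow> 'b::real_normed_vector set \<Rightarrow> ('a \<times> 'b \<Rightarrow> real) \<Rightarrow> bool" where
  "prox_lipschitz X Y g \<longleftrightarrow>
     (\<exists>L>0. \<exists>sbar>0. \<forall>x\<in>X. \<forall>x'\<in>X. \<forall>t\<in>Y. \<forall>s\<in>{0<..sbar}.
        \<forall>u\<in>prox_g_tilde Y g s x t. \<forall>u'\<in>prox_g_tilde Y g s x' t. norm (u - u') \<le> L * norm (x - x'))"

text \<open>
  Alternative (iv) is \<open>prox_lipschitz\<close> together with \<open>regular_constants\<close>. The first three
  alternatives are instances of it, so in every case \<open>\<rho>1\<close>, \<open>\<rho>2\<close>, \<open>L\<close> are admissible
  constants for (iv); the second conjunct only says which numbers the three names denote.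
\<close>

definition g_assumption ::
    "(real^'n) set \<Rightarrow> (real^'m) set \<Rightarrow> ((real^'n) \<times> (real^'m) \<Rightarrow> real) \<Rightarrow> real \<Rightarrow> real \<Rightarrow> real \<Rightarrow> bool" where
  "g_assumption X Y g \<rho>1 \<rho>2 L \<longleftrightarrow>
     (g_case_i Y g \<or> g_case_ii X Y g \<or> g_case_iii X Y g \<or> prox_lipschitz X Y g) \<and>
     regular_constants X Y g \<rho>1 \<rho>2 L"

definition moreau_objective ::
    "('a \<times> 'b::real_normed_vector \<Rightarrow> real) \<Rightarrow> real \<Rightarrow> 'a \<Rightarrow> 'b \<Rightarrow> 'b \<Rightarrow> real" where
  "moreau_objective \<phi> \<gamma> x y t = \<phi> (x, t) + 1 / (2 * \<gamma>) * (norm (t - y))\<^sup>2"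

definition moreau ::
    "'b::real_normed_vector set \<Rightarrow> ('a \<times> 'b \<Rightarrow> real) \<Rightarrow> real \<Rightarrow> 'a \<Rightarrow> 'b \<Rightarrow> real" where
  "moreau Y \<phi> \<gamma> x y = (INF t\<in>Y. moreau_objective \<phi> \<gamma> x y t)"

definition moreau_minimizer ::
    "'b::real_normed_vector set \<Rightarrow> ('a \<times> 'b \<Rightarrow> real) \<Rightarrow> real \<Rightarrow> 'a \<Rightarrow> 'b \<Rightarrow> 'b" where
  "moreau_minimizer Y \<phi> \<gamma> x y = arg_min_on (moreau_objective \<phi> \<gamma> x y) Y"

text \<open>
  The gradient of the envelope is given by its explicit formula: at boundary points of \<open>X\<close> a
  gradient in the whole space need not exist, since nothing is assumed about \<open>f\<close> and \<open>g\<close>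
  outside \<open>X \<times> Y\<close>.
\<close>

definition moreau_gradient ::
    "'b::real_inner set \<Rightarrow> ('a::real_inner \<times> 'b \<Rightarrow> real) \<Rightarrow> ('a \<times> 'b \<Rightarrow> real) \<Rightarrow> real \<Rightarrow> 'a \<times> 'b \<Rightarrow> 'a \<times> 'b" where
  "moreau_gradient Y f g \<gamma> = (\<lambda>(x, y).
     let t = moreau_minimizer Y (\<lambda>z. f z + g z) \<gamma> x y
     in (gradient_x f x t + gradient_x g x t, (1 / \<gamma>) *\<^sub>R (y - t)))"

definition penalty_fun ::
    "'b::real_normed_vector set \<Rightarrow> ('a \<times> 'b \<Rightarrow> real) \<Rightarrow> ('a \<times> 'b \<Rightarrow> real) \<Rightarrow> real \<Rightarrow> real \<Rightarrow> 'a \<Rightarrow> 'b \<Rightarrow> real" where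
  "penalty_fun Y F \<phi> \<gamma> c x y = F (x, y) + c * (\<phi> (x, y) - moreau Y \<phi> \<gamma> x y)"

definition normal_cone :: "'a::real_inner set \<Rightarrow> 'a \<Rightarrow> 'a set" where
  "normal_cone S z = {v. \<forall>w\<in>S. inner v (w - z) \<le> 0}"

text \<open>
  Frechet (regular) subdifferential of \<open>h\<close> restricted to \<open>S\<close>, that is, of the extended-valued
  function which is \<open>h\<close> on \<open>S\<close> and \<open>\<infinity>\<close> elsewhere. For \<open>S = UNIV\<close>, or at interior points
  of \<open>S\<close>, it is the subdifferential of \<open>h\<close> itself.
\<close>

definition frechet_subdifferential_on :: "'a::real_inner set \<Rightarrow> ('a \<Rightarrow> real) \<Rightarrow> 'a \<Rightarrow> 'a set" where
  "frechet_subdifferential_on S h z =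
     {\<xi>. \<forall>\<epsilon>>0. \<forall>\<^sub>F w in at z within S. h w \<ge> h z + inner \<xi> (w - z) - \<epsilon> * norm (w - z)}"

lemma frechet_subdifferential_on_interior:
  assumes "z \<in> interior S"
  shows "frechet_subdifferential_on S h z = frechet_subdifferential_on UNIV h z"
  unfolding frechet_subdifferential_on_def at_within_interior[OF assms] ..

lemma frechet_subdifferential_on_plus_normal:
  assumes "\<xi> \<in> frechet_subdifferential_on UNIV h z" and "\<nu> \<in> normal_cone S z"
  shows "\<xi> + \<nu> \<in> frechet_subdifferential_on S h z"
  unfolding frechet_subdifferential_on_def
proof (intro CollectI allI impI)
  fix \<epsilon> :: real assume "\<epsilon> > 0"
  then have "\<forall>\<^sub>F w in at z. h w \<ge> h z + inner \<xi> (w - z) - \<epsilon> * norm (w - z)"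
    using assms(1) unfolding frechet_subdifferential_on_def by blast
  then have "\<forall>\<^sub>F w in at z within S. h w \<ge> h z + inner \<xi> (w - z) - \<epsilon> * norm (w - z)"
    using at_le[of S UNIV z] by (auto intro: filter_leD)
  moreover have "\<forall>\<^sub>F w in at z within S. w \<in> S"
    by (simp add: eventually_at_filter)
  ultimately show "\<forall>\<^sub>F w in at z within S. h w \<ge> h z + inner (\<xi> + \<nu>) (w - z) - \<epsilon> * norm (w - z)"
  proof eventually_elim
    case (elim w)
    then have "inner \<nu> (w - z) \<le> 0" using assms(2) unfolding normal_cone_def by blast
    then show ?case using elim by (simp add: inner_add_left)
  qed
qed

text \<open>
  \<open>F\<close>, \<open>f\<close>, \<open>g\<close> matter only on \<open>X \<times> Y\<close>, and the optimality conditions of the proximal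
  steps hold relative to \<open>Y\<close>; accordingly the subdifferential of \<open>g\<close> is taken on \<open>X \<times> Y\<close>.
  The distance is extended-valued because \<open>infdist\<close> to the empty set would be \<open>0\<close>.
\<close>

definition residual ::
    "'a::real_inner set \<Rightarrow> 'b::real_inner set \<Rightarrow> ('a \<times> 'b \<Rightarrow> real) \<Rightarrow> ('a \<times> 'b \<Rightarrow> real) \<Rightarrow> ('a \<times> 'b \<Rightarrow> real) \<Rightarrow>
     real \<Rightarrow> real \<Rightarrow> 'a \<times> 'b \<Rightarrow> ereal" where
  "residual X Y F f g \<gamma> c z =
     (INF e \<in> {gradient F z + c *\<^sub>R (gradient f z + \<xi> - moreau_gradient Y f g \<gamma> z) + \<nu> | \<xi> \<nu>.
                 \<xi> \<in> frechet_subdifferential_on (X \<times> Y) g z \<and> \<nu> \<in> normal_cone (X \<times> Y) z}.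
        ereal (dist 0 e))"

definition meha ::
    "'a::euclidean_space set \<Rightarrow> 'b::euclidean_space set \<Rightarrow>
     ('a \<times> 'b \<Rightarrow> real) \<Rightarrow> ('a \<times> 'b \<Rightarrow> real) \<Rightarrow> ('a \<times> 'b \<Rightarrow> real) \<Rightarrow>
     real \<Rightarrow> (nat \<Rightarrow> real) \<Rightarrow> (nat \<Rightarrow> real) \<Rightarrow> (nat \<Rightarrow> real) \<Rightarrow> (nat \<Rightarrow> real) \<Rightarrow>
     (nat \<Rightarrow> 'a) \<Rightarrow> (nat \<Rightarrow> 'b) \<Rightarrow> (nat \<Rightarrow> 'b) \<Rightarrow> bool" where
  "meha X Y F f g \<gamma> c \<alpha> \<beta> \<eta> x y \<theta> \<longleftrightarrow>
     (\<forall>k.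
        let dx = (1 / c k) *\<^sub>R gradient_x F (x k) (y k)
                 + gradient_x f (x k) (y k) + gradient_x g (x k) (y k)
                 - gradient_x f (x k) (\<theta> (Suc k)) - gradient_x g (x k) (\<theta> (Suc k));
            dy = (1 / c k) *\<^sub>R gradient_y F (x (Suc k)) (y k)
                 + gradient_y f (x (Suc k)) (y k) - (1 / \<gamma>) *\<^sub>R (y k - \<theta> (Suc k))
        in \<theta> (Suc k) \<in> prox_g_tilde Y g (\<eta> k) (x k)
              (\<theta> k - \<eta> k *\<^sub>R (gradient_y f (x k) (\<theta> k) + (1 / \<gamma>) *\<^sub>R (\<theta> k - y k))) \<and>
           x (Suc k) = closest_point X (x k - \<alpha> k *\<^sub>R dx) \<and>
           y (Suc k) \<in> prox_g_tilde Y g (\<beta> k) (x (Suc k)) (y k - \<beta> k *\<^sub>R dy))"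

end

theory Submission
  imports Defs
begin

text \<open>
  The approximate lower-level solution \<open>\<theta>\<^sup>k\<close> is a proximal gradient step on a strongly convex problem,
  so it tracks the exact minimizer \<open>\<theta>\<^sub>\<gamma>\<^sup>*(x\<^sup>k, y\<^sup>k)\<close> with a contraction factor \<open>\<sigma> < 1\<close>, and that minimizer
  is Lipschitz in \<open>(x, y)\<close>. For short steps in \<open>x\<close> and \<open>y\<close> the merit function
  \<open>(F - inf F) / c\<^sub>k + \<phi> - v\<^sub>\<gamma>\<close> decreases up to an error governed by the tracking error. Adding a multiple
  of the squared tracking error gives a nonnegative Lyapunov function whose decrease dominates
  \<open>\<parallel>x\<^sup>k\<^sup>+\<^sup>1 - x\<^sup>k\<parallel>\<^sup>2 + \<parallel>y\<^sup>k\<^sup>+\<^sup>1 - y\<^sup>k\<parallel>\<^sup>2 + \<parallel>\<theta>\<^sup>k - \<theta>\<^sub>\<gamma>\<^sup>*\<parallel>\<^sup>2\<close>; these terms are therefore summable, and the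
  optimality conditions of the two steps bound the residual by \<open>c\<^sub>k\<close> times their square roots.
  The envelope need not be differentiable: comparing values at the minimizers of neighbouring
  points gives the one-sided estimate for \<open>- v\<^sub>\<gamma>\<close> that the descent needs.
\<close>

subsection \<open>Gradients and proximal steps\<close>

text \<open>The one-dimensional mean value theorem along the segment from \<open>z\<close> to
  \<open>w\<close>. The distance bound on \<open>u\<close> lets a Lipschitz estimate for
  \<open>D u - D z\<close> be stated in terms of \<open>norm (w - z)\<close>.\<close>

lemma gderiv_mean_value:
  fixes h :: "'a::real_inner \<Rightarrow> real"
  assumes S: "convex S" "z \<in> S" "w \<in> S" and h: "\<And>u. u \<in> S \<Longrightarrow> GDERIV h u :> D u"
  obtains u where "u \<in> S" "norm (u - z) \<le> norm (w - z)" "h w - h z = inner (D u) (w - z)"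
proof -
  define p where "p s = z + s *\<^sub>R (w - z)" for s :: real
  have pS: "p s \<in> S" if "0 \<le> s" "s \<le> 1" for s
    using convexD_alt[OF S that] by (simp add: p_def algebra_simps)
  have "((\<lambda>s. h (p s)) has_real_derivative inner (D (p s)) (w - z)) (at s)"
    if "0 \<le> s" "s \<le> 1" for s
  proof -
    have "(h has_derivative (\<lambda>v. inner v (D (p s)))) (at (p s))"
      using h[OF pS[OF that]] by (simp add: gderiv_def)
    moreover have "(p has_derivative (\<lambda>t. t *\<^sub>R (w - z))) (at s)"
      unfolding p_def by (auto intro!: derivative_eq_intros)
    ultimately have "((\<lambda>s. h (p s)) has_derivative (\<lambda>t. inner (t *\<^sub>R (w - z)) (D (p s)))) (at s)"
      using has_derivative_compose by blast
    then show ?thesis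
      by (simp add: has_field_derivative_def inner_commute mult.commute[of _ "inner _ _"])
  qed
  then obtain s where s: "0 < s" "s < 1" "h (p 1) - h (p 0) = (1 - 0) * inner (D (p s)) (w - z)"
    using MVT2[of 0 1 "\<lambda>s. h (p s)" "\<lambda>s. inner (D (p s)) (w - z)"] by auto
  have "norm (p s - z) = s * norm (w - z)" using s by (simp add: p_def)
  also have "\<dots> \<le> norm (w - z)" using s by (simp add: mult_left_le_one_le)
  finally show ?thesis using that[of "p s"] s pS[of s] by (auto simp: p_def)
qed

lemma abs_inner_le: "norm a \<le> A \<Longrightarrow> \<bar>inner a b\<bar> \<le> A * norm b"
  by (meson Cauchy_Schwarz_ineq2 mult_right_mono norm_ge_zero order_trans)

text \<open>The descent lemma, obtained from the mean value theorem instead of an integral, hence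
  with \<open>L\<close> in place of \<open>L / 2\<close>. The factor only affects how short the
  steps must be.\<close>

lemma gderiv_quadratic_bound:
  fixes h :: "'a::real_inner \<Rightarrow> real"
  assumes "convex S" "z \<in> S" "w \<in> S" "\<And>u. u \<in> S \<Longrightarrow> GDERIV h u :> D u"
    and L: "\<And>u u'. u \<in> S \<Longrightarrow> u' \<in> S \<Longrightarrow> norm (D u - D u') \<le> L * norm (u - u')" "0 \<le> L"
  shows "\<bar>h w - h z - inner (D z) (w - z)\<bar> \<le> L * (norm (w - z))\<^sup>2"
proof -
  obtain u where u: "u \<in> S" "norm (u - z) \<le> norm (w - z)" "h w - h z = inner (D u) (w - z)"
    using gderiv_mean_value assms(1-4) by metis
  have "norm (D u - D z) \<le> L * norm (u - z)" using L(1) u(1) assms(2) by blast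
  also have "\<dots> \<le> L * norm (w - z)" using u L(2) by (simp add: mult_left_mono)
  finally have "\<bar>inner (D u - D z) (w - z)\<bar> \<le> L * norm (w - z) * norm (w - z)"
    by (rule abs_inner_le)
  then show ?thesis using u by (simp add: inner_diff_left power2_eq_square mult.assoc)
qed

text \<open>Along a segment the defect of convexity of the squared norm is exactly
  \<open>s * (1 - s) * (norm (t - u))\<^sup>2\<close>; this is the price for removing the added
  quadratic.\<close>

lemma weakly_convex_on_segment:
  assumes "weakly_convex_on \<rho> S h" "u \<in> S" "t \<in> S" "0 \<le> s" "s \<le> 1"
  shows "h (u + s *\<^sub>R (t - u)) \<le> (1 - s) * h u + s * h t + \<rho> / 2 * (s * (1 - s)) * (norm (t - u))\<^sup>2"
proof -
  have eq: "(1 - s) *\<^sub>R u + s *\<^sub>R t = u + s *\<^sub>R (t - u)" by (simp add: algebra_simps)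
  have "h (u + s *\<^sub>R (t - u)) + \<rho> / 2 * (norm (u + s *\<^sub>R (t - u)))\<^sup>2
      \<le> (1 - s) * (h u + \<rho> / 2 * (norm u)\<^sup>2) + s * (h t + \<rho> / 2 * (norm t)\<^sup>2)"
    using convex_onD[OF assms(1)[unfolded weakly_convex_on_def], of s u t] assms eq by auto
  moreover have "(1 - s) * (norm u)\<^sup>2 + s * (norm t)\<^sup>2 - (norm (u + s *\<^sub>R (t - u)))\<^sup>2
      = s * (1 - s) * (norm (t - u))\<^sup>2"
    unfolding power2_norm_eq_inner
    by (simp add: inner_add inner_diff algebra_simps inner_commute power2_eq_square)
  then have "\<rho> / 2 * ((1 - s) * (norm u)\<^sup>2 + s * (norm t)\<^sup>2 - (norm (u + s *\<^sub>R (t - u)))\<^sup>2)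
      = \<rho> / 2 * (s * (1 - s)) * (norm (t - u))\<^sup>2" by simp
  moreover have "(1 - s) * (h u + \<rho> / 2 * (norm u)\<^sup>2) + s * (h t + \<rho> / 2 * (norm t)\<^sup>2)
      = (1 - s) * h u + s * h t + \<rho> / 2 * ((1 - s) * (norm u)\<^sup>2 + s * (norm t)\<^sup>2)"
  proof -
    have "(1 - s) * (H + r * a) + s * (T + r * b) = (1 - s) * H + s * T + r * ((1 - s) * a + s * b)"
      for H T r a b :: real by (simp add: algebra_simps)
    then show ?thesis .
  qed
  ultimately show ?thesis by (simp only: right_diff_distrib)
qed

text \<open>First-order condition for a smooth plus a weakly convex term: \<open>- D\<close> is a
  subgradient of \<open>h\<close> at \<open>u\<close> relative to \<open>Y\<close>, up to a
  quadratic error. The minimizer is compared with points moving from \<open>u\<close> towards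
  \<open>t\<close>; dividing by the parameter \<open>s\<close> and letting it tend to 0 from the
  right turns the increment of \<open>q\<close> into its directional derivative.\<close>

lemma weakly_convex_minimizer_optimality:
  fixes h q :: "'a::real_inner \<Rightarrow> real"
  assumes Y: "convex Y" "u \<in> Y" "t \<in> Y" and h: "weakly_convex_on \<rho> Y h" "0 \<le> \<rho>"
    and q: "GDERIV q u :> D" and min: "\<And>w. w \<in> Y \<Longrightarrow> q u + h u \<le> q w + h w"
  shows "h u - inner D (t - u) - \<rho> / 2 * (norm (t - u))\<^sup>2 \<le> h t"
proof -
  let ?r = "\<lambda>s. q (u + s *\<^sub>R (t - u))"
  have "(q has_derivative (\<lambda>v. inner v D)) (at (u + 0 *\<^sub>R (t - u)))"
    using q by (simp add: gderiv_def)
  moreover have "((\<lambda>s::real. u + s *\<^sub>R (t - u)) has_derivative (\<lambda>s. s *\<^sub>R (t - u))) (at 0)"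
    by (auto intro!: derivative_eq_intros)
  ultimately have "(?r has_derivative (\<lambda>s. inner (s *\<^sub>R (t - u)) D)) (at 0)"
    using has_derivative_compose by blast
  then have "(?r has_real_derivative inner D (t - u)) (at 0)"
    by (simp add: has_field_derivative_def inner_commute mult.commute[of _ "inner _ _"])
  then have "((\<lambda>s. (?r s - q u) / s) \<longlongrightarrow> inner D (t - u)) (at_right 0)"
    using filterlim_at_split by (auto simp: DERIV_def)
  moreover have "\<forall>\<^sub>F s in at_right 0. h u - h t - \<rho> / 2 * (norm (t - u))\<^sup>2 \<le> (?r s - q u) / s"
    unfolding eventually_at_right_field
  proof (intro exI[of _ 1] conjI allI impI)
    fix s :: real assume s: "0 < s" "s < 1"
    have "u + s *\<^sub>R (t - u) \<in> Y"
      using convexD_alt[OF Y, of s] s by (simp add: algebra_simps)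
    from min[OF this] weakly_convex_on_segment[OF h(1) Y(2,3), of s] s
    have "s * (h u - h t) - \<rho> / 2 * (s * (1 - s)) * (norm (t - u))\<^sup>2 \<le> ?r s - q u"
      by (simp add: algebra_simps)
    moreover have "\<rho> / 2 * (s * (1 - s)) * (norm (t - u))\<^sup>2 \<le> \<rho> / 2 * s * (norm (t - u))\<^sup>2"
      using s h(2) by (intro mult_right_mono mult_left_mono) auto
    moreover have "s * (h u - h t - \<rho> / 2 * (norm (t - u))\<^sup>2)
        = s * (h u - h t) - \<rho> / 2 * s * (norm (t - u))\<^sup>2" by (simp add: algebra_simps)
    ultimately have "s * (h u - h t - \<rho> / 2 * (norm (t - u))\<^sup>2) \<le> ?r s - q u" by linarith
    then show "h u - h t - \<rho> / 2 * (norm (t - u))\<^sup>2 \<le> (?r s - q u) / s"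
      using s by (simp add: field_simps)
  qed simp
  ultimately have "h u - h t - \<rho> / 2 * (norm (t - u))\<^sup>2 \<le> inner D (t - u)"
    using tendsto_lowerbound trivial_limit_at_right_real by blast
  then show ?thesis by linarith
qed

section \<open>Partial gradients of a jointly smooth function\<close>

lemma gderiv_fst:
  assumes "GDERIV h (x, y) :> D"
  shows "GDERIV (\<lambda>u. h (u, y)) x :> fst D"
proof -
  have "(h has_derivative (\<lambda>v. inner v D)) (at (x, y))" using assms by (simp add: gderiv_def)
  moreover have "((\<lambda>u. (u, y)) has_derivative (\<lambda>u. (u, 0))) (at x)"
    by (auto intro!: derivative_eq_intros)
  ultimately have "((\<lambda>u. h (u, y)) has_derivative (\<lambda>u. inner (u, 0) D)) (at x)"
    using has_derivative_compose by blast
  then show ?thesis by (simp add: gderiv_def inner_prod_def)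
qed

lemma gderiv_snd:
  assumes "GDERIV h (x, y) :> D"
  shows "GDERIV (\<lambda>v. h (x, v)) y :> snd D"
proof -
  have "(h has_derivative (\<lambda>v. inner v D)) (at (x, y))" using assms by (simp add: gderiv_def)
  moreover have "((\<lambda>v. (x, v)) has_derivative (\<lambda>v. (0, v))) (at y)"
    by (auto intro!: derivative_eq_intros)
  ultimately have "((\<lambda>v. h (x, v)) has_derivative (\<lambda>v. inner (0, v) D)) (at y)"
    using has_derivative_compose by blast
  then show ?thesis by (simp add: gderiv_def inner_prod_def)
qed

lemma norm_prod_le: "norm (z :: 'a::real_normed_vector \<times> 'b::real_normed_vector) \<le> norm (fst z) + norm (snd z)"
  by (cases z) (simp add: norm_Pair_le)

lemma norm_diff_prod_lipschitz:
  assumes "L-lipschitz_on (X \<times> Y) h" "x \<in> X" "x' \<in> X" "y \<in> Y" "y' \<in> Y"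
  shows "norm (h (x, y) - h (x', y')) \<le> L * (norm (x - x') + norm (y - y'))"
proof -
  have "norm (h (x, y) - h (x', y')) \<le> L * norm ((x, y) - (x', y'))"
    using lipschitz_onD[OF assms(1), of "(x, y)" "(x', y')"] assms by (simp add: dist_norm)
  also have "\<dots> \<le> L * (norm (x - x') + norm (y - y'))"
    using lipschitz_on_nonneg[OF assms(1)] norm_prod_le[of "(x, y) - (x', y')"]
    by (intro mult_left_mono) auto
  finally show ?thesis .
qed

context
  fixes X :: "'a::real_inner set" and Y :: "'b::real_inner set" and h L
  assumes h: "smooth_on_with L (X \<times> Y) h"
begin

lemma smooth_gderiv:
  assumes "x \<in> X" "y \<in> Y"
  shows "GDERIV h (x, y) :> gradient h (x, y)"
  using h assms gradient_eqI[of h "(x, y)"] unfolding smooth_on_with_def by blast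

lemma smooth_gradient_x:
  assumes "x \<in> X" "y \<in> Y"
  shows "GDERIV (\<lambda>u. h (u, y)) x :> gradient_x h x y" "gradient_x h x y = fst (gradient h (x, y))"
  using gderiv_fst[OF smooth_gderiv[OF assms]] by (simp_all add: gradient_x_def gradient_eqI)

lemma smooth_gradient_y:
  assumes "x \<in> X" "y \<in> Y"
  shows "GDERIV (\<lambda>v. h (x, v)) y :> gradient_y h x y" "gradient_y h x y = snd (gradient h (x, y))"
  using gderiv_snd[OF smooth_gderiv[OF assms]] by (simp_all add: gradient_y_def gradient_eqI)

lemma smooth_gradient_x_lipschitz:
  assumes "x \<in> X" "x' \<in> X" "y \<in> Y" "y' \<in> Y"
  shows "norm (gradient_x h x y - gradient_x h x' y') \<le> L * (norm (x - x') + norm (y - y'))"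
proof -
  have "norm (gradient h (x, y) - gradient h (x', y')) \<le> L * (norm (x - x') + norm (y - y'))"
    using norm_diff_prod_lipschitz h assms unfolding smooth_on_with_def by blast
  moreover have "gradient_x h x y - gradient_x h x' y' = fst (gradient h (x, y) - gradient h (x', y'))"
    using assms by (simp add: smooth_gradient_x(2))
  moreover have "norm (fst z) \<le> norm z" for z :: "'a \<times> 'b"
    by (metis norm_fst_le prod.collapse)
  ultimately show ?thesis by (metis order_trans)
qed

lemma smooth_gradient_y_lipschitz:
  assumes "x \<in> X" "x' \<in> X" "y \<in> Y" "y' \<in> Y"
  shows "norm (gradient_y h x y - gradient_y h x' y') \<le> L * (norm (x - x') + norm (y - y'))"
proof -
  have "norm (gradient h (x, y) - gradient h (x', y')) \<le> L * (norm (x - x') + norm (y - y'))"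
    using norm_diff_prod_lipschitz h assms unfolding smooth_on_with_def by blast
  moreover have "gradient_y h x y - gradient_y h x' y' = snd (gradient h (x, y) - gradient h (x', y'))"
    using assms by (simp add: smooth_gradient_y(2))
  moreover have "norm (snd z) \<le> norm z" for z :: "'a \<times> 'b"
    by (metis norm_snd_le prod.collapse)
  ultimately show ?thesis by (metis order_trans)
qed

end

section \<open>Optimality of proximal points\<close>

lemma prox_g_tilde_minimizer:
  assumes "u \<in> prox_g_tilde Y g s x w" "0 < s" "Y \<noteq> {}"
  shows "u \<in> Y" "\<And>t. t \<in> Y \<Longrightarrow> (norm (u - w))\<^sup>2 / 2 + s * g (x, u) \<le> (norm (t - w))\<^sup>2 / 2 + s * g (x, t)"
proof -
  let ?h = "\<lambda>t. ereal s * g_tilde Y g x t + ereal ((norm (t - w))\<^sup>2 / 2)"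
  have val: "?h t = ereal (s * g (x, t) + (norm (t - w))\<^sup>2 / 2)" if "t \<in> Y" for t
    using that by (simp add: g_tilde_def indicator_ereal_def)
  \<comment> \<open>A positive \<open>s\<close> matters here: in the extended reals
    \<open>0 * \<infinity> = 0\<close>, and the constraint would be lost.\<close>
  have inf: "?h t = \<infinity>" if "t \<notin> Y" for t
    using that assms by (simp add: g_tilde_def indicator_ereal_def)
  have min: "?h u \<le> ?h t" for t
    using assms(1) by (auto simp: prox_g_tilde_def prox_def is_arg_min_def not_less)
  show uY: "u \<in> Y"
  proof (rule ccontr)
    assume "u \<notin> Y"
    moreover obtain t where "t \<in> Y" using assms by auto
    ultimately show False using min[of t] val[of t] inf[of u] by (metis ereal_infty_less_eq(1) PInfty_neq_ereal(1))
  qed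
  show "(norm (u - w))\<^sup>2 / 2 + s * g (x, u) \<le> (norm (t - w))\<^sup>2 / 2 + s * g (x, t)" if "t \<in> Y" for t
    using min[of t] val[OF that] val[OF uY] by simp
qed

lemma gderiv_half_norm_diff:
  fixes w :: "'a::real_inner"
  shows "GDERIV (\<lambda>t. (norm (t - w))\<^sup>2 / 2) u :> u - w"
  unfolding gderiv_def power2_norm_eq_inner
  by (auto intro!: derivative_eq_intros simp: inner_commute)

text \<open>Up to the weak convexity error, \<open>(w - u) / s\<close> is a subgradient of
  \<open>g (x, _)\<close> at the proximal point \<open>u\<close>; everything is kept multiplied by
  \<open>s\<close>.\<close>

lemma prox_g_tilde_optimality:
  fixes Y :: "'b::real_inner set"
  assumes u: "u \<in> prox_g_tilde Y g s x w" "0 < s"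
    and Y: "convex Y" "t \<in> Y" and g: "weakly_convex_on \<rho> Y (\<lambda>t. g (x, t))" "0 \<le> \<rho>"
  shows "s * g (x, u) + inner (w - u) (t - u) - s * \<rho> / 2 * (norm (t - u))\<^sup>2 \<le> s * g (x, t)"
proof -
  have ne: "Y \<noteq> {}" using Y by auto
  have "weakly_convex_on (s * \<rho>) Y (\<lambda>t. s * g (x, t))"
  proof -
    have "convex_on Y (\<lambda>t. s * (g (x, t) + \<rho> / 2 * (norm t)\<^sup>2))"
      using convex_on_cmul u(2) g(1) unfolding weakly_convex_on_def by (metis less_imp_le)
    then show ?thesis by (simp add: weakly_convex_on_def algebra_simps)
  qed
  from weakly_convex_minimizer_optimality[OF Y(1) prox_g_tilde_minimizer(1)[OF u ne] Y(2) this _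
      gderiv_half_norm_diff prox_g_tilde_minimizer(2)[OF u ne]]
  have "s * g (x, u) - inner (u - w) (t - u) - s * \<rho> / 2 * (norm (t - u))\<^sup>2 \<le> s * g (x, t)"
    using u(2) g(2) by simp
  then show ?thesis by (simp add: inner_diff_left)
qed

subsection \<open>The lower-level problem\<close>

text \<open>The form of the assumptions in which they enter the estimates. \<open>\<rho>\<close> is
  the weak convexity constant of \<open>g\<close> in its second argument, and the second condition
  on \<open>\<gamma>\<close> says that the contraction gain
  \<open>(1 / \<gamma> - Lf) / 2 - \<rho>\<close> is positive. \<open>clow\<close> is a uniform
  lower bound for the penalty parameters.\<close>

locale meha_problem =
  fixes X :: "'a::euclidean_space set" and Y :: "'b::euclidean_space set"
    and F f g :: "'a \<times> 'b \<Rightarrow> real" and LF Lf \<rho>\<^sub>1 \<rho> Lg \<gamma> Flow clow :: real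
  assumes X: "closed X" "convex X" "X \<noteq> {}" and Y: "convex Y" "Y \<noteq> {}"
    and F: "smooth_on_with LF (X \<times> Y) F" "\<And>z. z \<in> X \<times> Y \<Longrightarrow> Flow \<le> F z"
    and f: "smooth_on_with Lf (X \<times> Y) f"
    and g: "regular_constants X Y g \<rho>\<^sub>1 \<rho> Lg"
    and gamma: "0 < \<gamma>" "Lf + 2 * \<rho> < 1 / \<gamma>"
    and minimizer_exists: "\<And>x y. x \<in> X \<Longrightarrow> y \<in> Y \<Longrightarrow>
          \<exists>t. is_arg_min (moreau_objective (\<lambda>z. f z + g z) \<gamma> x y) (\<lambda>t. t \<in> Y) t"
    and clow: "0 < clow"
begin

abbreviation \<phi> where "\<phi> z \<equiv> f z + g z"
abbreviation obj where "obj \<equiv> moreau_objective \<phi> \<gamma>"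
abbreviation \<theta>s where "\<theta>s \<equiv> moreau_minimizer Y \<phi> \<gamma>"
abbreviation v where "v \<equiv> moreau Y \<phi> \<gamma>"
abbreviation gx where "gx x y \<equiv> gradient_x f x y + gradient_x g x y"

lemma nonneg: "0 \<le> \<rho>" "0 \<le> Lf" "0 \<le> Lg" "0 \<le> LF"
  using F(1) f g lipschitz_on_nonneg unfolding regular_constants_def smooth_on_with_def by blast+

text \<open>With \<open>x\<close> frozen, the quadratic in \<open>x\<close> is the same constant on
  both sides of the joint convexity inequality and cancels.\<close>

lemma weakly_convex_snd: "weakly_convex_on \<rho> Y (\<lambda>t. g (x, t))" if "x \<in> X"
  unfolding weakly_convex_on_def convex_on_def
proof (intro conjI Y ballI allI impI)
  fix s t a b assume st: "s \<in> Y" "t \<in> Y" and ab: "0 \<le> a" "0 \<le> b" "a + b = (1::real)"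
  have *: "a *\<^sub>R x + b *\<^sub>R x = x" "a * r + b * r = r" for r
    using ab by (simp_all flip: scaleR_left_distrib distrib_right)
  have "convex_on (X \<times> Y) (\<lambda>(x, y). g (x, y) + \<rho>\<^sub>1 / 2 * (norm x)\<^sup>2 + \<rho> / 2 * (norm y)\<^sup>2)"
    using g by (simp add: regular_constants_def weakly_convex2_on_def)
  then have "(\<lambda>(x, y). g (x, y) + \<rho>\<^sub>1 / 2 * (norm x)\<^sup>2 + \<rho> / 2 * (norm y)\<^sup>2) (a *\<^sub>R (x, s) + b *\<^sub>R (x, t))
     \<le> a * (\<lambda>(x, y). g (x, y) + \<rho>\<^sub>1 / 2 * (norm x)\<^sup>2 + \<rho> / 2 * (norm y)\<^sup>2) (x, s)
       + b * (\<lambda>(x, y). g (x, y) + \<rho>\<^sub>1 / 2 * (norm x)\<^sup>2 + \<rho> / 2 * (norm y)\<^sup>2) (x, t)"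
    using st ab that unfolding convex_on_def by blast
  moreover have ident: "a * (S + K + S') + b * (T + K + T') = K + (a * (S + S') + b * (T + T'))" for K S S' T T'
    using *(2)[of K] by (simp add: algebra_simps)
  ultimately show "g (x, a *\<^sub>R s + b *\<^sub>R t) + \<rho> / 2 * (norm (a *\<^sub>R s + b *\<^sub>R t))\<^sup>2
     \<le> a * (g (x, s) + \<rho> / 2 * (norm s)\<^sup>2) + b * (g (x, t) + \<rho> / 2 * (norm t)\<^sup>2)"
    by (simp only: scaleR_Pair add_Pair prod.case *(1) ident)
qed

lemma gderiv_g: "GDERIV (\<lambda>u. g (u, y)) x :> gradient_x g x y" if "x \<in> X" "y \<in> Y"
  using g that gradient_eqI unfolding regular_constants_def gradient_x_def by metis

lemma gradient_x_g_lipschitz: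
  assumes "x \<in> X" "x' \<in> X" "y \<in> Y" "y' \<in> Y"
  shows "norm (gradient_x g x y - gradient_x g x' y') \<le> Lg * (norm (x - x') + norm (y - y'))"
  using norm_diff_prod_lipschitz[of Lg X Y "\<lambda>(x, y). gradient_x g x y"] g assms
  by (auto simp: regular_constants_def)

lemma gderiv_\<phi>: "GDERIV (\<lambda>u. \<phi> (u, y)) x :> gx x y" if "x \<in> X" "y \<in> Y"
  using GDERIV_add gderiv_g smooth_gradient_x(1)[OF f] that by blast

lemma gx_lipschitz:
  assumes "x \<in> X" "x' \<in> X" "y \<in> Y" "y' \<in> Y"
  shows "norm (gx x y - gx x' y') \<le> (Lf + Lg) * (norm (x - x') + norm (y - y'))"
proof -
  have "norm (gx x y - gx x' y') \<le> norm (gradient_x f x y - gradient_x f x' y')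
      + norm (gradient_x g x y - gradient_x g x' y')"
    using norm_triangle_ineq[of "gradient_x f x y - gradient_x f x' y'"
        "gradient_x g x y - gradient_x g x' y'"] by (simp add: algebra_simps)
  then show ?thesis
    using gradient_x_g_lipschitz[OF assms] smooth_gradient_x_lipschitz[OF f assms]
    by (simp add: distrib_right)
qed

text \<open>\<open>moreau_minimizer\<close> is defined by choice; the existence hypothesis makes the
  chosen point a minimizer.\<close>

lemma \<theta>s_minimizer:
  assumes "x \<in> X" "y \<in> Y"
  shows "\<theta>s x y \<in> Y" "\<And>t. t \<in> Y \<Longrightarrow> obj x y (\<theta>s x y) \<le> obj x y t"
proof -
  have "is_arg_min (obj x y) (\<lambda>t. t \<in> Y) (\<theta>s x y)"
    unfolding moreau_minimizer_def arg_min_on_def arg_min_def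
    using minimizer_exists[OF assms] by (rule someI_ex)
  then show "\<theta>s x y \<in> Y" "\<And>t. t \<in> Y \<Longrightarrow> obj x y (\<theta>s x y) \<le> obj x y t"
    by (auto simp: is_arg_min_def not_less)
qed

lemma moreau_eq: "v x y = obj x y (\<theta>s x y)" if "x \<in> X" "y \<in> Y"
  unfolding moreau_def by (rule cInf_eq_minimum) (use \<theta>s_minimizer[OF that] in auto)

lemma moreau_le: "v x y \<le> obj x y t" if "x \<in> X" "y \<in> Y" "t \<in> Y"
  using moreau_eq \<theta>s_minimizer that by simp

lemma moreau_le_\<phi>: "v x y \<le> \<phi> (x, y)" if "x \<in> X" "y \<in> Y"
  using moreau_le[OF that that(2)] by (simp add: moreau_objective_def)

text \<open>The gradient in \<open>t\<close> of the smooth part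
  \<open>f (x, t) + (norm (t - y))\<^sup>2 / (2 * \<gamma>)\<close> of the lower-level
  objective.\<close>

abbreviation qy where "qy x y t \<equiv> gradient_y f x t + (1 / \<gamma>) *\<^sub>R (t - y)"

lemma \<theta>s_optimality:
  assumes "x \<in> X" "y \<in> Y" "t \<in> Y"
  shows "g (x, \<theta>s x y) - inner (qy x y (\<theta>s x y)) (t - \<theta>s x y)
     - \<rho> / 2 * (norm (t - \<theta>s x y))\<^sup>2 \<le> g (x, t)"
proof (rule weakly_convex_minimizer_optimality[OF Y(1) _ assms(3) weakly_convex_snd nonneg(1)])
  show "x \<in> X" "\<theta>s x y \<in> Y" using assms \<theta>s_minimizer by auto
  let ?q = "\<lambda>t. f (x, t) + 1 / \<gamma> * ((norm (t - y))\<^sup>2 / 2)"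
  show "GDERIV ?q (\<theta>s x y) :> qy x y (\<theta>s x y)"
  proof (rule GDERIV_add[OF smooth_gradient_y(1)[OF f]])
    show "x \<in> X" "\<theta>s x y \<in> Y" by fact+
    show "GDERIV (\<lambda>t. 1 / \<gamma> * ((norm (t - y))\<^sup>2 / 2)) (\<theta>s x y) :> (1 / \<gamma>) *\<^sub>R (\<theta>s x y - y)"
      using GDERIV_mult[OF GDERIV_const[of "1 / \<gamma>"] gderiv_half_norm_diff] by simp
  qed
  show "?q (\<theta>s x y) + g (x, \<theta>s x y) \<le> ?q w + g (x, w)" if "w \<in> Y" for w
    using \<theta>s_minimizer(2)[OF assms(1,2) that] by (simp add: moreau_objective_def)
qed

text \<open>The proximal quadratic contributes \<open>1 / \<gamma>\<close>, and the Lipschitz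
  gradient of \<open>f\<close> can take away at most \<open>Lf\<close>.\<close>

lemma qy_monotone:
  assumes "x \<in> X" "t \<in> Y" "t' \<in> Y"
  shows "(1 / \<gamma> - Lf) * (norm (t - t'))\<^sup>2 \<le> inner (qy x y t - qy x y t') (t - t')"
proof -
  have "\<bar>inner (gradient_y f x t - gradient_y f x t') (t - t')\<bar> \<le> Lf * norm (t - t') * norm (t - t')"
    using smooth_gradient_y_lipschitz[OF f assms(1,1) assms(2,3)] by (intro abs_inner_le) simp
  then have "- (Lf * (norm (t - t'))\<^sup>2) \<le> inner (gradient_y f x t - gradient_y f x t') (t - t')"
    by (simp add: power2_eq_square mult.assoc)
  moreover have "inner (qy x y t - qy x y t') (t - t')
     = inner (gradient_y f x t - gradient_y f x t') (t - t') + 1 / \<gamma> * (norm (t - t'))\<^sup>2"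
  proof -
    have "qy x y t - qy x y t' = (gradient_y f x t - gradient_y f x t') + (1 / \<gamma>) *\<^sub>R (t - t')"
      by (simp add: algebra_simps)
    then show ?thesis by (simp only: inner_add_left inner_scaleR_left power2_norm_eq_inner)
  qed
  ultimately show ?thesis by (simp add: left_diff_distrib)
qed

text \<open>The numerator bounds the change of the optimality condition with \<open>(x, y)\<close>,
  the denominator is the strong convexity modulus of the lower-level objective.\<close>

definition L\<theta> where "L\<theta> = (Lf + Lg + 1 / \<gamma>) / (1 / \<gamma> - Lf - \<rho>)"

lemma L\<theta>_nonneg: "0 \<le> L\<theta>"
  using nonneg gamma by (auto simp: L\<theta>_def intro!: divide_nonneg_nonneg)

text \<open>Each of the two minimizers is tested in the optimality condition of the other, and the
  inequalities are added. Strong monotonicity of \<open>qy\<close> bounds the sum from below; what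
  remains is the perturbation caused by changing \<open>x\<close> and \<open>y\<close>, which is
  linear in \<open>N\<close>, so one factor \<open>N\<close> cancels.\<close>

lemma \<theta>s_lipschitz:
  assumes "x \<in> X" "x' \<in> X" "y \<in> Y" "y' \<in> Y"
  shows "norm (\<theta>s x y - \<theta>s x' y') \<le> L\<theta> * (norm (x - x') + norm (y - y'))"
proof -
  define u u' where "u = \<theta>s x y" and "u' = \<theta>s x' y'"
  define N where "N = norm (u - u')"
  have uY: "u \<in> Y" "u' \<in> Y" using \<theta>s_minimizer(1) assms by (auto simp: u_def u'_def)
  have 1: "g (x, u) - inner (qy x y u) (u' - u) - \<rho> / 2 * N\<^sup>2 \<le> g (x, u')"
    using \<theta>s_optimality[OF assms(1,3) uY(2)] by (simp add: u_def N_def norm_minus_commute)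
  have 2: "g (x', u') - inner (qy x' y' u') (u - u') - \<rho> / 2 * N\<^sup>2 \<le> g (x', u)"
    using \<theta>s_optimality[OF assms(2,4) uY(1)] by (simp add: u'_def N_def)
  \<comment> \<open>Adding the conditions leaves a mixed difference of \<open>g\<close>. The mean
    value theorem is applied in the first argument, where \<open>g\<close> is differentiable; the
    Lipschitz bound on its partial gradient then supplies the factor \<open>N\<close>.\<close>
  have "\<And>w. w \<in> X \<Longrightarrow> GDERIV (\<lambda>w. g (w, u') - g (w, u)) w :> gradient_x g w u' - gradient_x g w u"
    using GDERIV_diff gderiv_g uY by blast
  then obtain w where w: "w \<in> X" "(g (x, u') - g (x, u)) - (g (x', u') - g (x', u))
      = inner (gradient_x g w u' - gradient_x g w u) (x - x')"
    using gderiv_mean_value[OF X(2) assms(2,1),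
        of "\<lambda>w. g (w, u') - g (w, u)" "\<lambda>w. gradient_x g w u' - gradient_x g w u"] by blast
  have 3: "\<bar>inner (gradient_x g w u' - gradient_x g w u) (x - x')\<bar> \<le> Lg * N * norm (x - x')"
    using gradient_x_g_lipschitz[OF w(1,1) uY(2,1)]
    by (intro abs_inner_le) (simp add: N_def norm_minus_commute)
  have "inner (qy x y u - qy x' y' u') (u - u') \<le> Lg * N * norm (x - x') + \<rho> * N\<^sup>2"
    using 1 2 3 w(2) by (simp add: inner_diff_left inner_diff_right)
  moreover have "inner (qy x y u - qy x' y' u') (u - u') = inner (qy x y u - qy x y u') (u - u')
     + inner (gradient_y f x u' - gradient_y f x' u') (u - u') - 1 / \<gamma> * inner (y - y') (u - u')"
  proof -
    have "qy x y u - qy x' y' u' = (qy x y u - qy x y u') + (gradient_y f x u' - gradient_y f x' u')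
        - (1 / \<gamma>) *\<^sub>R (y - y')" by (simp add: algebra_simps)
    then show ?thesis by (simp only: inner_add_left inner_diff_left[of "_ + _"] inner_scaleR_left)
  qed
  moreover have "(1 / \<gamma> - Lf) * N\<^sup>2 \<le> inner (qy x y u - qy x y u') (u - u')"
    using qy_monotone[OF assms(1) uY] by (simp add: N_def)
  moreover have "\<bar>inner (gradient_y f x u' - gradient_y f x' u') (u - u')\<bar> \<le> Lf * norm (x - x') * N"
    using smooth_gradient_y_lipschitz[OF f assms(1,2) uY(2,2)] unfolding N_def
    by (intro abs_inner_le) simp
  moreover have "1 / \<gamma> * inner (y - y') (u - u') \<le> 1 / \<gamma> * (norm (y - y') * N)"
    using gamma norm_cauchy_schwarz[of "y - y'" "u - u'"] by (intro mult_left_mono) (auto simp: N_def)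
  ultimately have "(1 / \<gamma> - Lf - \<rho>) * N\<^sup>2
      \<le> (Lg + Lf) * norm (x - x') * N + 1 / \<gamma> * (norm (y - y') * N)"
    by (simp add: algebra_simps)
  moreover have "(Lg + Lf) * norm (x - x') * N + 1 / \<gamma> * (norm (y - y') * N)
      \<le> (Lf + Lg + 1 / \<gamma>) * (norm (x - x') + norm (y - y')) * N"
  proof -
    have "0 \<le> (Lf + Lg) * (norm (y - y') * N) + 1 / \<gamma> * (norm (x - x') * N)"
      using nonneg gamma by (auto simp: N_def)
    then show ?thesis by (simp add: algebra_simps)
  qed
  ultimately have "((1 / \<gamma> - Lf - \<rho>) * N) * N
      \<le> ((Lf + Lg + 1 / \<gamma>) * (norm (x - x') + norm (y - y'))) * N"
    by (simp add: power2_eq_square mult.assoc)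
  then have "(1 / \<gamma> - Lf - \<rho>) * N \<le> (Lf + Lg + 1 / \<gamma>) * (norm (x - x') + norm (y - y'))"
  proof (cases "N = 0")
    case True then show ?thesis using nonneg gamma by simp
  next
    case False
    then have "0 < N" by (simp add: N_def)
    then show ?thesis using \<open>_ * N \<le> _ * N\<close> mult_le_cancel_right_pos by blast
  qed
  then show ?thesis using gamma nonneg
    by (simp add: L\<theta>_def N_def u_def u'_def pos_le_divide_eq mult.commute)
qed

text \<open>
  The gradient step contracts by \<open>sqrt (1 - \<eta> \<mu>) \<le> 1 - \<eta> \<mu> / 2\<close> with \<open>\<mu> = 1 / \<gamma> - Lf\<close>, the proximal step
  expands by at most \<open>1 / (1 - \<eta> \<rho>)\<close>.
\<close>

lemma theta_contraction:
  assumes xy: "x \<in> X" "y \<in> Y" "\<theta> \<in> Y"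
    and e: "0 < \<eta>" "\<eta> \<le> (1 / \<gamma> - Lf) / (Lf + 1 / \<gamma>)\<^sup>2" "\<eta> * \<rho> < 1"
    and \<theta>p: "\<theta>p \<in> prox_g_tilde Y g \<eta> x (\<theta> - \<eta> *\<^sub>R qy x y \<theta>)"
  shows "norm (\<theta>p - \<theta>s x y) \<le> (1 - \<eta> * ((1 / \<gamma> - Lf) / 2 - \<rho>)) * norm (\<theta> - \<theta>s x y)"
proof -
  define s where "s = \<theta>s x y"
  define \<mu> l where "\<mu> = 1 / \<gamma> - Lf" and "l = Lf + 1 / \<gamma>"
  define a b where "a = \<theta> - s" and "b = qy x y \<theta> - qy x y s"
  have mem: "s \<in> Y" "\<theta>p \<in> Y"
    using \<theta>s_minimizer(1)[OF xy(1,2)] prox_g_tilde_minimizer(1)[OF \<theta>p e(1) Y(2)] by (auto simp: s_def)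
  have \<mu>: "2 * \<rho> < \<mu>" "0 < \<mu>" "0 < l" "\<mu> \<le> l" using gamma nonneg by (auto simp: \<mu>_def l_def add_nonneg_pos)
  have el: "\<eta> * l\<^sup>2 \<le> \<mu>" using e(2) \<mu> by (simp add: \<mu>_def[symmetric] l_def[symmetric] pos_le_divide_eq)
  \<comment> \<open>Follows from \<open>\<eta> * l\<^sup>2 \<le> \<mu> \<le> l\<close>; it keeps the
    factor \<open>1 - \<eta> * \<mu> / 2\<close> nonnegative when square roots are taken
    below.\<close>
  have "\<eta> * \<mu> \<le> 1"
  proof -
    have "\<eta> * \<mu> * l \<le> \<eta> * l\<^sup>2" using e \<mu> by (simp add: power2_eq_square mult.commute mult.assoc)
    also have "\<dots> \<le> 1 * l" using el \<mu> by simp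
    finally show ?thesis using \<mu> mult_le_cancel_right_pos by blast
  qed
  \<comment> \<open>The condition at \<open>\<theta>p\<close> is tested with \<open>s\<close>, and
    the one at \<open>s\<close> with \<open>\<theta>p\<close>; in the sum the values of
    \<open>g\<close> cancel.\<close>
  have "\<eta> * g (x, \<theta>p) + inner (\<theta> - \<eta> *\<^sub>R qy x y \<theta> - \<theta>p) (s - \<theta>p) - \<eta> * \<rho> / 2 * (norm (s - \<theta>p))\<^sup>2
      \<le> \<eta> * g (x, s)"
    by (rule prox_g_tilde_optimality[OF \<theta>p e(1) Y(1) mem(1) weakly_convex_snd[OF xy(1)] nonneg(1)])
  moreover have "\<eta> * (g (x, s) - inner (qy x y s) (\<theta>p - s) - \<rho> / 2 * (norm (\<theta>p - s))\<^sup>2) \<le> \<eta> * g (x, \<theta>p)"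
    using \<theta>s_optimality[OF xy(1,2) mem(2)] e(1) by (intro mult_left_mono) (auto simp: s_def)
  moreover have "inner (\<theta> - \<eta> *\<^sub>R qy x y \<theta> - \<theta>p) (s - \<theta>p) - \<eta> * inner (qy x y s) (\<theta>p - s)
      = (norm (\<theta>p - s))\<^sup>2 - inner (a - \<eta> *\<^sub>R b) (\<theta>p - s)"
  proof -
    have "\<theta> - \<eta> *\<^sub>R P - \<theta>p = (\<theta> - s - \<eta> *\<^sub>R (P - Q)) - \<eta> *\<^sub>R Q - (\<theta>p - s)" for P Q
      by (simp add: scaleR_diff_right)
    then have "\<theta> - \<eta> *\<^sub>R qy x y \<theta> - \<theta>p = (a - \<eta> *\<^sub>R b) - \<eta> *\<^sub>R qy x y s - (\<theta>p - s)"
      unfolding a_def b_def .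
    moreover have "s - \<theta>p = - (\<theta>p - s)" by simp
    ultimately show ?thesis
      unfolding power2_norm_eq_inner
      by (simp only: inner_minus_right inner_diff_left[of "_ - _"] inner_scaleR_left)
  qed
  ultimately have "(norm (\<theta>p - s))\<^sup>2 - inner (a - \<eta> *\<^sub>R b) (\<theta>p - s) \<le> \<eta> * \<rho> * (norm (\<theta>p - s))\<^sup>2"
    by (simp add: algebra_simps norm_minus_commute)
  moreover have "inner (a - \<eta> *\<^sub>R b) (\<theta>p - s) \<le> norm (a - \<eta> *\<^sub>R b) * norm (\<theta>p - s)"
    by (rule norm_cauchy_schwarz)
  ultimately have "((1 - \<eta> * \<rho>) * norm (\<theta>p - s)) * norm (\<theta>p - s) \<le> norm (a - \<eta> *\<^sub>R b) * norm (\<theta>p - s)"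
    by (simp add: algebra_simps power2_eq_square)
  then have prox_part: "(1 - \<eta> * \<rho>) * norm (\<theta>p - s) \<le> norm (a - \<eta> *\<^sub>R b)"
    by (cases "norm (\<theta>p - s) = 0") (auto simp: mult_le_cancel_right)
  have ab: "\<mu> * (norm a)\<^sup>2 \<le> inner b a"
    using qy_monotone[OF xy(1,3) mem(1)] by (simp add: a_def b_def \<mu>_def)
  have "norm b \<le> l * norm a"
  proof -
    have "b = (gradient_y f x \<theta> - gradient_y f x s) + (1 / \<gamma>) *\<^sub>R a"
      by (simp add: a_def b_def algebra_simps)
    then have "norm b \<le> norm (gradient_y f x \<theta> - gradient_y f x s) + norm ((1 / \<gamma>) *\<^sub>R a)"
      using norm_triangle_ineq by metis
    also have "\<dots> \<le> Lf * norm a + 1 / \<gamma> * norm a"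
      using smooth_gradient_y_lipschitz[OF f xy(1,1,3) mem(1)] gamma by (simp add: a_def)
    finally show ?thesis by (simp add: l_def distrib_right)
  qed
  then have b2: "(norm b)\<^sup>2 \<le> l\<^sup>2 * (norm a)\<^sup>2"
    by (metis norm_ge_zero power_mono power_mult_distrib)
  have "(norm (a - \<eta> *\<^sub>R b))\<^sup>2 = (norm a)\<^sup>2 - 2 * \<eta> * inner b a + \<eta>\<^sup>2 * (norm b)\<^sup>2"
    unfolding power2_norm_eq_inner
    by (simp add: inner_diff_left inner_diff_right inner_commute power2_eq_square)
  \<comment> \<open>Monotonicity gains \<open>2 * \<eta> * \<mu>\<close>, while the quadratic term
    costs at most \<open>\<eta>\<^sup>2 * l\<^sup>2 \<le> \<eta> * \<mu>\<close>. The net factor is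
    \<open>1 - \<eta> * \<mu> \<le> (1 - \<eta> * \<mu> / 2)\<^sup>2\<close>.\<close>
  also have "\<dots> \<le> (norm a)\<^sup>2 - 2 * \<eta> * (\<mu> * (norm a)\<^sup>2) + \<eta> * \<mu> * (norm a)\<^sup>2"
  proof -
    have "2 * \<eta> * (\<mu> * (norm a)\<^sup>2) \<le> 2 * \<eta> * inner b a" using ab e(1) by (intro mult_left_mono) auto
    moreover have "\<eta>\<^sup>2 * (norm b)\<^sup>2 \<le> \<eta> * \<mu> * (norm a)\<^sup>2"
    proof -
      have "\<eta>\<^sup>2 * (norm b)\<^sup>2 \<le> \<eta>\<^sup>2 * (l\<^sup>2 * (norm a)\<^sup>2)" using b2 by (intro mult_left_mono) auto
      also have "\<dots> = \<eta> * (norm a)\<^sup>2 * (\<eta> * l\<^sup>2)" by (simp add: power2_eq_square)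
      also have "\<dots> \<le> \<eta> * (norm a)\<^sup>2 * \<mu>" using el e(1) by (intro mult_left_mono) auto
      finally show ?thesis by (simp add: mult.assoc mult.commute[of _ \<mu>])
    qed
    ultimately show ?thesis by linarith
  qed
  also have "\<dots> \<le> ((1 - \<eta> * \<mu> / 2) * norm a)\<^sup>2"
  proof -
    have "((1 - \<eta> * \<mu> / 2) * norm a)\<^sup>2 = (1 - \<eta> * \<mu> + (\<eta> * \<mu> / 2)\<^sup>2) * (norm a)\<^sup>2"
      by (simp add: power_mult_distrib power2_diff)
    moreover have "0 \<le> (\<eta> * \<mu> / 2)\<^sup>2 * (norm a)\<^sup>2" by simp
    ultimately show ?thesis by (simp add: algebra_simps)
  qed
  finally have "(norm (a - \<eta> *\<^sub>R b))\<^sup>2 \<le> ((1 - \<eta> * \<mu> / 2) * norm a)\<^sup>2" .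
  moreover have "0 \<le> (1 - \<eta> * \<mu> / 2) * norm a"
    using \<open>\<eta> * \<mu> \<le> 1\<close> by (intro mult_nonneg_nonneg) simp_all
  ultimately have "norm (a - \<eta> *\<^sub>R b) \<le> (1 - \<eta> * \<mu> / 2) * norm a"
    by (rule power2_le_imp_le)
  \<comment> \<open>The product exceeds \<open>1 - \<eta> * \<mu> / 2\<close> by
    \<open>\<eta>\<^sup>2 * \<rho> * (\<mu> / 2 - \<rho>)\<close>, which is nonnegative; this form
    lets the proximal factor \<open>1 - \<eta> * \<rho>\<close> cancel.\<close>
  also have "\<dots> \<le> ((1 - \<eta> * \<rho>) * (1 - \<eta> * (\<mu> / 2 - \<rho>))) * norm a"
  proof (rule mult_right_mono)
    have "0 \<le> \<rho> * (\<mu> / 2 - \<rho>)" using nonneg \<mu> by (intro mult_nonneg_nonneg) auto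
    then have "0 \<le> \<eta>\<^sup>2 * (\<rho> * (\<mu> / 2 - \<rho>))" by (rule mult_nonneg_nonneg[rotated]) simp
    moreover have "(1 - \<eta> * \<rho>) * (1 - \<eta> * d) = 1 - \<eta> * (\<rho> + d) + \<eta>\<^sup>2 * (\<rho> * d)" for d
      by (simp add: algebra_simps power2_eq_square)
    ultimately show "1 - \<eta> * \<mu> / 2 \<le> (1 - \<eta> * \<rho>) * (1 - \<eta> * (\<mu> / 2 - \<rho>))"
      by simp
  qed simp
  finally have "(1 - \<eta> * \<rho>) * norm (\<theta>p - s) \<le> (1 - \<eta> * \<rho>) * ((1 - \<eta> * (\<mu> / 2 - \<rho>)) * norm a)"
    using prox_part by (simp add: mult.assoc)
  then show ?thesis using e(3) by (simp add: mult_le_cancel_left_pos a_def s_def \<mu>_def)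
qed

end

subsection \<open>Descent of the Lyapunov function\<close>

text \<open>A quadratic error is below \<open>\<epsilon> * norm (w - z)\<close> within radius
  \<open>\<epsilon> / (\<bar>q\<bar> + 1)\<close>; the added 1 keeps the denominator positive for
  every \<open>q\<close>.\<close>

lemma frechet_subdifferential_onI_quadratic:
  assumes "\<And>w. w \<in> S \<Longrightarrow> h z + inner \<xi> (w - z) - q * (norm (w - z))\<^sup>2 \<le> h w"
  shows "\<xi> \<in> frechet_subdifferential_on S h z"
  unfolding frechet_subdifferential_on_def
proof (intro CollectI allI impI)
  fix \<epsilon> :: real assume e: "0 < \<epsilon>"
  have small: "q * (norm d)\<^sup>2 \<le> \<epsilon> * norm d" if "norm d < \<epsilon> / (\<bar>q\<bar> + 1)" for d :: 'a
  proof -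
    have "(\<bar>q\<bar> + 1) * norm d \<le> \<epsilon>" using that by (simp add: field_simps)
    moreover have "q * norm d \<le> (\<bar>q\<bar> + 1) * norm d" by (rule mult_right_mono) auto
    ultimately have "q * norm d * norm d \<le> \<epsilon> * norm d" by (intro mult_right_mono) auto
    then show ?thesis by (simp add: power2_eq_square mult.assoc)
  qed
  have "0 < \<epsilon> / (\<bar>q\<bar> + 1)" using e by (simp add: add_nonneg_pos)
  moreover have "h z + inner \<xi> (w - z) - \<epsilon> * norm (w - z) \<le> h w"
    if "w \<in> S" "dist w z < \<epsilon> / (\<bar>q\<bar> + 1)" for w
    using assms[OF that(1)] small[of "w - z"] that(2) by (simp add: dist_norm)
  ultimately show "\<forall>\<^sub>F w in at z within S. h w \<ge> h z + inner \<xi> (w - z) - \<epsilon> * norm (w - z)"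
    unfolding eventually_at by blast
qed

lemma norm_prod_ge: "norm a * norm b \<le> (norm (a, b))\<^sup>2" "(norm a)\<^sup>2 \<le> (norm (a, b))\<^sup>2" "(norm b)\<^sup>2 \<le> (norm (a, b))\<^sup>2"
proof -
  have eq: "(norm (a, b))\<^sup>2 = (norm a)\<^sup>2 + (norm b)\<^sup>2" by (simp add: norm_Pair)
  then show "(norm a)\<^sup>2 \<le> (norm (a, b))\<^sup>2" "(norm b)\<^sup>2 \<le> (norm (a, b))\<^sup>2" by simp_all
  have "2 * (norm a * norm b) \<le> (norm a)\<^sup>2 + (norm b)\<^sup>2"
    using sum_squares_bound[of "norm a" "norm b"] by (simp add: mult.assoc)
  moreover have "0 \<le> norm a * norm b" by simp
  ultimately show "norm a * norm b \<le> (norm (a, b))\<^sup>2" unfolding eq by linarith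
qed

lemma norm_diff_diff_le: "norm (a - b - c) \<le> norm a + norm b + norm (c :: 'a::real_normed_vector)"
  using norm_triangle_ineq4[of "a - b" c] norm_triangle_ineq4[of a b] by linarith

text \<open>Convexity of the square with weights \<open>\<sigma>\<close> and
  \<open>1 - \<sigma>\<close>; the gap is a perfect square over
  \<open>\<sigma> * (1 - \<sigma>)\<close>. For \<open>a \<le> \<sigma> * E\<close> with
  \<open>a\<close> nonnegative, the first term is at most \<open>\<sigma> * E\<^sup>2\<close>, so a
  contraction survives the addition of a drift \<open>b\<close>.\<close>

lemma square_add_le_convex_weights:
  fixes a b \<sigma> :: real
  assumes "0 < \<sigma>" "\<sigma> < 1"
  shows "(a + b)\<^sup>2 \<le> a\<^sup>2 / \<sigma> + b\<^sup>2 / (1 - \<sigma>)"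
proof -
  have "a\<^sup>2 / \<sigma> + b\<^sup>2 / (1 - \<sigma>) - (a + b)\<^sup>2 = ((1 - \<sigma>) * a - \<sigma> * b)\<^sup>2 / (\<sigma> * (1 - \<sigma>))"
    using assms by (simp add: divide_simps power2_eq_square) algebra
  moreover have "0 \<le> ((1 - \<sigma>) * a - \<sigma> * b)\<^sup>2 / (\<sigma> * (1 - \<sigma>))" using assms by simp
  ultimately show ?thesis by linarith
qed

context meha_problem
begin

section \<open>Merit function and its change along the two steps\<close>

abbreviation dx where "dx c x y t \<equiv> (1 / c) *\<^sub>R gradient_x F x y + gradient_x f x y + gradient_x g x y
    - gradient_x f x t - gradient_x g x t"

abbreviation dy where "dy c x y t \<equiv> (1 / c) *\<^sub>R gradient_y F x y + gradient_y f x y - (1 / \<gamma>) *\<^sub>R (y - t)"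

text \<open>The penalty function shifted by \<open>Flow\<close> and divided by \<open>c\<close>: the
  shift makes it nonnegative, and the division makes it decrease when the penalty parameter
  grows.\<close>

definition merit where "merit c x y = (F (x, y) - Flow) / c + \<phi> (x, y) - v x y"

lemma merit_nonneg: "0 \<le> merit c x y" if "x \<in> X" "y \<in> Y" "0 < c"
proof -
  have "0 \<le> (F (x, y) - Flow) / c" using F(2)[of "(x, y)"] that by simp
  then show ?thesis using moreau_le_\<phi>[OF that(1,2)] by (simp add: merit_def)
qed

lemma merit_antimono: "merit c' x y \<le> merit c x y" if "x \<in> X" "y \<in> Y" "0 < c" "c \<le> c'"
  using F(2)[of "(x, y)"] that by (simp add: merit_def frac_le)

text \<open>Replaces \<open>LF / c\<close> by \<open>LF / clow\<close>, so that the curvature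
  constants are the same for all iterations.\<close>

lemma scaled_upper_bound:
  fixes a b q c :: real
  assumes "a \<le> b + LF * q" "clow \<le> c" "0 \<le> q"
  shows "a / c \<le> b / c + LF / clow * q"
proof -
  have "a / c \<le> (b + LF * q) / c" using assms clow by (intro divide_right_mono) auto
  also have "\<dots> = b / c + LF * q / c" by (rule add_divide_distrib)
  also have "LF * q / c \<le> LF * q / clow" using assms clow nonneg by (intro divide_left_mono) auto
  finally show ?thesis by simp
qed

text \<open>These collect the coefficients of the squared step lengths other than the gain
  \<open>1 / \<alpha>\<close> or \<open>1 / \<beta>\<close>. The terms with \<open>L\<theta>\<close>
  come from the drift of the lower-level minimizer; in \<open>curvature_x\<close> the factor 2
  accounts for expanding \<open>\<phi>\<close> both at \<open>y\<close> and at the new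
  minimizer.\<close>

definition curvature_x where "curvature_x = LF / clow + 2 * (Lf + Lg) + (Lf + Lg) * L\<theta>"
definition curvature_y where "curvature_y = LF / clow + Lf + \<rho> + L\<theta> / \<gamma>"

lemma merit_x_step:
  assumes mem: "x \<in> X" "x' \<in> X" "y \<in> Y" "t \<in> Y" and c: "clow \<le> c"
    and proj: "inner (dx c x y t) (x' - x) \<le> - (norm (x' - x))\<^sup>2 / \<alpha>"
  shows "merit c x' y - merit c x y
      \<le> - (1 / \<alpha> - curvature_x) * (norm (x' - x))\<^sup>2 + (Lf + Lg) * norm (t - \<theta>s x y) * norm (x' - x)"
proof -
  define D where "D = norm (x' - x)"
  define s' where "s' = \<theta>s x' y"
  have s': "s' \<in> Y" using \<theta>s_minimizer(1) mem by (simp add: s'_def)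
  have "F (x', y) - F (x, y) \<le> inner (gradient_x F x y) (x' - x) + LF * D\<^sup>2"
    using gderiv_quadratic_bound[OF X(2) mem(1,2) smooth_gradient_x(1)[OF F(1) _ mem(3)], of LF]
      smooth_gradient_x_lipschitz[OF F(1) _ _ mem(3,3)] nonneg by (simp add: D_def)
  from scaled_upper_bound[OF this c]
  have 1: "(F (x', y) - F (x, y)) / c \<le> inner (gradient_x F x y) (x' - x) / c + LF / clow * D\<^sup>2" by simp
  have \<phi>_bound: "\<bar>\<phi> (x', w) - \<phi> (x, w) - inner (gx x w) (x' - x)\<bar> \<le> (Lf + Lg) * D\<^sup>2" if "w \<in> Y" for w
    using gderiv_quadratic_bound[OF X(2) mem(1,2) gderiv_\<phi>[OF _ that], of "Lf + Lg"]
      gx_lipschitz[OF _ _ that that] nonneg by (simp add: D_def)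
  \<comment> \<open>\<open>s'\<close> is optimal for \<open>(x', y)\<close> and merely a competitor
    for \<open>(x, y)\<close>. This gives the needed lower bound on the change of the envelope, and
    the proximal terms cancel since \<open>y\<close> is unchanged.\<close>
  have 2: "\<phi> (x', s') - \<phi> (x, s') \<le> v x' y - v x y"
    using moreau_eq[OF mem(2,3)] moreau_le[OF mem(1,3) s'] by (simp add: s'_def moreau_objective_def)
  have "norm (t - s') \<le> norm (t - \<theta>s x y) + norm (\<theta>s x y - s')"
    using norm_triangle_ineq[of "t - \<theta>s x y" "\<theta>s x y - s'"] by simp
  also have "norm (\<theta>s x y - s') \<le> L\<theta> * D"
    using \<theta>s_lipschitz[OF mem(1,2,3,3)] by (simp add: s'_def D_def norm_minus_commute)
  finally have "(Lf + Lg) * norm (t - s') \<le> (Lf + Lg) * (norm (t - \<theta>s x y) + L\<theta> * D)"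
    using nonneg by (intro mult_left_mono) auto
  then have "norm (gx x t - gx x s') \<le> (Lf + Lg) * (norm (t - \<theta>s x y) + L\<theta> * D)"
    \<comment> \<open>The direction \<open>dx\<close> uses \<open>t\<close> where the estimate needs
      \<open>s'\<close>; their distance is the tracking error plus the drift
      \<open>L\<theta> * D\<close>.\<close>
    using gx_lipschitz[OF mem(1,1,4) s'] by simp
  from abs_inner_le[OF this, of "x' - x"]
  have "inner (gx x t - gx x s') (x' - x) \<le> (Lf + Lg) * (norm (t - \<theta>s x y) + L\<theta> * D) * D"
    unfolding D_def by linarith
  then have 3: "inner (gx x t) (x' - x) - inner (gx x s') (x' - x)
      \<le> (Lf + Lg) * norm (t - \<theta>s x y) * D + (Lf + Lg) * L\<theta> * D\<^sup>2"
    by (simp only: inner_diff_left) (simp add: algebra_simps power2_eq_square)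
  have "dx c x y t = (1 / c) *\<^sub>R gradient_x F x y + gx x y - gx x t" by simp
  then have 4: "inner (dx c x y t) (x' - x)
      = inner (gradient_x F x y) (x' - x) / c + inner (gx x y) (x' - x) - inner (gx x t) (x' - x)"
    by (simp only: inner_diff_left[of "_ - _"] inner_diff_left inner_add_left[of "_ *\<^sub>R _"] inner_scaleR_left) simp
  have "merit c x' y - merit c x y
      = (F (x', y) - F (x, y)) / c + (\<phi> (x', y) - \<phi> (x, y)) - (v x' y - v x y)"
    by (simp add: merit_def diff_divide_distrib)
  also have "\<dots> \<le> - D\<^sup>2 / \<alpha> + (LF / clow * D\<^sup>2 + 2 * ((Lf + Lg) * D\<^sup>2) + (Lf + Lg) * L\<theta> * D\<^sup>2)
      + (Lf + Lg) * norm (t - \<theta>s x y) * D"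
    using 1 2 3 4 \<phi>_bound[OF mem(3)] \<phi>_bound[OF s'] proj[folded D_def] by linarith
  finally show ?thesis by (simp add: D_def curvature_x_def algebra_simps)
qed

lemma merit_y_step:
  assumes mem: "x \<in> X" "y \<in> Y" "y' \<in> Y" and c: "clow \<le> c" and \<beta>: "0 < \<beta>"
    and prox: "y' \<in> prox_g_tilde Y g \<beta> x (y - \<beta> *\<^sub>R dy c x y t)"
  shows "merit c x y' - merit c x y
      \<le> - (1 / \<beta> - curvature_y) * (norm (y' - y))\<^sup>2 + 1 / \<gamma> * (norm (t - \<theta>s x y) * norm (y' - y))"
proof -
  define D where "D = norm (y' - y)"
  define s s' where "s = \<theta>s x y" and "s' = \<theta>s x y'"
  have s': "s' \<in> Y" using \<theta>s_minimizer(1) mem by (simp add: s'_def)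
  have "F (x, y') - F (x, y) \<le> inner (gradient_y F x y) (y' - y) + LF * D\<^sup>2"
    using gderiv_quadratic_bound[OF Y(1) mem(2,3) smooth_gradient_y(1)[OF F(1) mem(1)], of LF]
      smooth_gradient_y_lipschitz[OF F(1) mem(1,1)] nonneg by (simp add: D_def)
  from scaled_upper_bound[OF this c]
  have 1: "(F (x, y') - F (x, y)) / c \<le> inner (gradient_y F x y) (y' - y) / c + LF / clow * D\<^sup>2" by simp
  have 2: "f (x, y') - f (x, y) \<le> inner (gradient_y f x y) (y' - y) + Lf * D\<^sup>2"
    using gderiv_quadratic_bound[OF Y(1) mem(2,3) smooth_gradient_y(1)[OF f mem(1)], of Lf]
      smooth_gradient_y_lipschitz[OF f mem(1,1)] nonneg by (simp add: D_def)
  have "\<beta> * g (x, y') + inner (y - \<beta> *\<^sub>R dy c x y t - y') (y - y') - \<beta> * \<rho> / 2 * (norm (y - y'))\<^sup>2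
      \<le> \<beta> * g (x, y)"
    by (rule prox_g_tilde_optimality[OF prox \<beta> Y(1) mem(2) weakly_convex_snd[OF mem(1)] nonneg(1)])
  moreover have "inner (y - \<beta> *\<^sub>R w - y') (y - y') = D\<^sup>2 + \<beta> * inner w (y' - y)" for w
    unfolding D_def power2_norm_eq_inner
    by (simp add: inner_diff_left inner_diff_right inner_commute algebra_simps)
  ultimately have "\<beta> * (g (x, y') - g (x, y)) \<le> \<beta> * (- D\<^sup>2 / \<beta> - inner (dy c x y t) (y' - y) + \<rho> / 2 * D\<^sup>2)"
    using \<beta> by (simp add: D_def norm_minus_commute algebra_simps)
  then have 3: "g (x, y') - g (x, y) \<le> - D\<^sup>2 / \<beta> - inner (dy c x y t) (y' - y) + \<rho> / 2 * D\<^sup>2"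
    using \<beta> mult_le_cancel_left_pos by blast
  \<comment> \<open>The same competitor argument with \<open>x\<close> fixed: now
    \<open>\<phi> (x, s')\<close> cancels and only the difference of the proximal terms is
    left.\<close>
  have "1 / (2 * \<gamma>) * ((norm (s' - y'))\<^sup>2 - (norm (s' - y))\<^sup>2) \<le> v x y' - v x y"
    using moreau_eq[OF mem(1,3)] moreau_le[OF mem(1,2) s']
    by (simp add: s'_def moreau_objective_def algebra_simps)
  moreover have "(norm (s' - y'))\<^sup>2 - (norm (s' - y))\<^sup>2 = 2 * inner (y - s') (y' - y) + D\<^sup>2"
    unfolding D_def power2_norm_eq_inner
    by (simp add: inner_diff_left inner_diff_right inner_commute algebra_simps)
  moreover have "0 \<le> 1 / (2 * \<gamma>) * D\<^sup>2" using gamma by simp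
  ultimately have 4: "1 / \<gamma> * inner (y - s') (y' - y) \<le> v x y' - v x y"
    by (simp add: algebra_simps add_divide_distrib)
  have "norm (t - s') \<le> norm (t - s) + norm (s - s')"
    using norm_triangle_ineq[of "t - s" "s - s'"] by simp
  also have "norm (s - s') \<le> L\<theta> * D"
    using \<theta>s_lipschitz[OF mem(1,1,2,3)] by (simp add: s_def s'_def D_def norm_minus_commute)
  finally have "inner (s' - t) (y' - y) \<le> (norm (t - s) + L\<theta> * D) * D"
    using abs_inner_le[of "s' - t" "norm (t - s) + L\<theta> * D" "y' - y"] by (simp add: D_def norm_minus_commute)
  then have "1 / \<gamma> * inner (s' - t) (y' - y) \<le> 1 / \<gamma> * ((norm (t - s) + L\<theta> * D) * D)"
    using gamma by (intro mult_left_mono) auto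
  moreover have "inner (s' - t) (y' - y) = inner (y - t) (y' - y) - inner (y - s') (y' - y)"
    by (simp add: inner_diff_left)
  ultimately have 5: "1 / \<gamma> * inner (y - t) (y' - y) - 1 / \<gamma> * inner (y - s') (y' - y)
      \<le> 1 / \<gamma> * (norm (t - s) * D) + L\<theta> / \<gamma> * D\<^sup>2"
    by (simp add: algebra_simps power2_eq_square diff_divide_distrib add_divide_distrib)
  have 6: "inner (dy c x y t) (y' - y) = inner (gradient_y F x y) (y' - y) / c
      + inner (gradient_y f x y) (y' - y) - 1 / \<gamma> * inner (y - t) (y' - y)"
    by (simp only: inner_diff_left[of "_ + _"] inner_add_left inner_scaleR_left) simp
  have 7: "\<rho> / 2 * D\<^sup>2 \<le> \<rho> * D\<^sup>2" using nonneg by (intro mult_right_mono) auto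
  have "merit c x y' - merit c x y
      = (F (x, y') - F (x, y)) / c + (f (x, y') - f (x, y)) + (g (x, y') - g (x, y)) - (v x y' - v x y)"
    by (simp add: merit_def diff_divide_distrib)
  also have "\<dots> \<le> - D\<^sup>2 / \<beta> + (LF / clow * D\<^sup>2 + Lf * D\<^sup>2 + \<rho> * D\<^sup>2 + L\<theta> / \<gamma> * D\<^sup>2)
      + 1 / \<gamma> * (norm (t - s) * D)"
    using 1 2 3 4 5 6 7 by linarith
  finally show ?thesis by (simp add: D_def curvature_y_def s_def algebra_simps)
qed

text \<open>The obtuse angle property of the projection, divided by \<open>\<alpha>\<close>:
  \<open>- (1 / \<alpha>) *\<^sub>R (x' - x) - d\<close> is normal to \<open>X\<close> at
  \<open>x'\<close>. Testing it with the old point \<open>x\<close> gives the descent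
  inequality.\<close>

lemma projection_step:
  assumes "x \<in> X" "0 < \<alpha>" "x' = closest_point X (x - \<alpha> *\<^sub>R d)"
  shows "x' \<in> X" "w \<in> X \<Longrightarrow> inner (- (1 / \<alpha>) *\<^sub>R (x' - x) - d) (w - x') \<le> 0"
    "inner d (x' - x) \<le> - (norm (x' - x))\<^sup>2 / \<alpha>"
proof -
  show "x' \<in> X" using assms closest_point_in_set X by simp
  show *: "inner (- (1 / \<alpha>) *\<^sub>R (x' - x) - d) (w - x') \<le> 0" if "w \<in> X" for w
  proof -
    have "inner (x - \<alpha> *\<^sub>R d - x') (w - x') \<le> 0"
      using closest_point_dot[OF X(2,1) that] assms(3) by simp
    moreover have "x - \<alpha> *\<^sub>R d - x' = \<alpha> *\<^sub>R (- (1 / \<alpha>) *\<^sub>R (x' - x) - d)"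
      using assms(2) by (simp add: scaleR_diff_right)
    ultimately have "\<alpha> * inner (- (1 / \<alpha>) *\<^sub>R (x' - x) - d) (w - x') \<le> 0"
      by (simp only: inner_scaleR_left)
    then show ?thesis using assms(2) by (simp add: mult_le_0_iff)
  qed
  have "x - x' = - (x' - x)" by simp
  then have "1 / \<alpha> * (norm (x' - x))\<^sup>2 + inner d (x' - x) \<le> 0"
    using *[OF assms(1)] unfolding power2_norm_eq_inner
    by (simp only: inner_diff_left[of "_ *\<^sub>R _"] inner_scaleR_left inner_minus_right)
  then show "inner d (x' - x) \<le> - (norm (x' - x))\<^sup>2 / \<alpha>" by simp
qed

text \<open>
  The weight of the tracking error is chosen so that
  \<open>(Lf + Lg) / 2 + 1 / (2 * \<gamma>) + tracking_weight \<sigma> * \<sigma> = tracking_weight \<sigma> - 1\<close>: the contraction then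
  pays for the errors of both steps and leaves a surplus of one squared tracking error.
\<close>

definition tracking_weight where "tracking_weight \<sigma> = ((Lf + Lg) / 2 + 1 / (2 * \<gamma>) + 1) / (1 - \<sigma>)"
text \<open>The 2 comes from \<open>(P + Q)\<^sup>2 \<le> 2 * (P\<^sup>2 + Q\<^sup>2)\<close>, the
  denominator from splitting the square with weights \<open>\<sigma>\<close> and
  \<open>1 - \<sigma>\<close>.\<close>

definition drift_const where "drift_const \<sigma> = 2 * L\<theta>\<^sup>2 / (1 - \<sigma>)"
text \<open>The reciprocal is the stepsize bound. The summands are the surplus 1 kept in the
  decrease, the curvature, the halves of the cross terms, and the weighted drift of the
  minimizer.\<close>

definition step_const_x where "step_const_x \<sigma> = 1 + curvature_x + (Lf + Lg) / 2 + L\<theta> / (2 * \<gamma>) + tracking_weight \<sigma> * drift_const \<sigma>"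
definition step_const_y where "step_const_y \<sigma> = 1 + curvature_y + 1 / (2 * \<gamma>) + L\<theta> / (2 * \<gamma>) + tracking_weight \<sigma> * drift_const \<sigma>"
definition lyapunov where "lyapunov \<sigma> c x y \<theta> = merit c x y + tracking_weight \<sigma> * (norm (\<theta> - \<theta>s x y))\<^sup>2"

lemma constants_nonneg:
  assumes "\<sigma> < 1"
  shows "0 \<le> tracking_weight \<sigma>" "0 \<le> drift_const \<sigma>" "1 \<le> step_const_x \<sigma>" "1 \<le> step_const_y \<sigma>"
proof -
  show C: "0 \<le> tracking_weight \<sigma>" and M: "0 \<le> drift_const \<sigma>"
    using assms nonneg gamma by (simp_all add: tracking_weight_def drift_const_def)
  then have CM: "0 \<le> tracking_weight \<sigma> * drift_const \<sigma>" by simp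
  have L\<theta>: "0 \<le> L\<theta> / (2 * \<gamma>)" "0 \<le> (Lf + Lg) / 2" and "0 \<le> curvature_x" "0 \<le> curvature_y" "0 \<le> 1 / (2 * \<gamma>)"
    using L\<theta>_nonneg nonneg gamma clow by (auto simp: curvature_x_def curvature_y_def)
  have "1 \<le> 1 + r1 + r2 + r3 + r4" if "0 \<le> r1" "0 \<le> r2" "0 \<le> r3" "0 \<le> r4" for r1 r2 r3 r4 :: real
    using that by linarith
  then show "1 \<le> step_const_x \<sigma>" "1 \<le> step_const_y \<sigma>"
    unfolding step_const_x_def step_const_y_def using CM L\<theta> \<open>0 \<le> curvature_x\<close> \<open>0 \<le> curvature_y\<close> \<open>0 \<le> 1 / (2 * \<gamma>)\<close> by blast+
qed

text \<open>The merit function changes first from \<open>(x, y)\<close> to \<open>(x', y)\<close>,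
  then to \<open>(x', y')\<close>. Cross terms are split into squares; large
  \<open>1 / \<alpha>\<close> and \<open>1 / \<beta>\<close> absorb the squared steps, and the
  decrease of the weighted tracking error absorbs the squares of \<open>e\<close>. The parameter
  \<open>c\<close> is the same on both sides.\<close>

lemma lyapunov_step:
  assumes mem: "x \<in> X" "y \<in> Y" "y' \<in> Y" "t \<in> Y" and c: "clow \<le> c"
    and \<sigma>: "0 < \<sigma>" "\<sigma> < 1" "norm (t - \<theta>s x y) \<le> \<sigma> * norm (\<theta> - \<theta>s x y)"
    and \<alpha>: "0 < \<alpha>" "\<alpha> < 1 / step_const_x \<sigma>" and \<beta>: "0 < \<beta>" "\<beta> < 1 / step_const_y \<sigma>"
    and x': "x' = closest_point X (x - \<alpha> *\<^sub>R dx c x y t)"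
    and y': "y' \<in> prox_g_tilde Y g \<beta> x' (y - \<beta> *\<^sub>R dy c x' y t)"
  shows "lyapunov \<sigma> c x' y' t + ((norm (x' - x))\<^sup>2 + (norm (y' - y))\<^sup>2 + (norm (\<theta> - \<theta>s x y))\<^sup>2) \<le> lyapunov \<sigma> c x y \<theta>"
proof -
  define P Q E e E' where "P = norm (x' - x)" and "Q = norm (y' - y)" and "E = norm (\<theta> - \<theta>s x y)"
    and "e = norm (t - \<theta>s x y)" and "E' = norm (t - \<theta>s x' y')"
  have nn: "0 \<le> P" "0 \<le> Q" "0 \<le> E" "0 \<le> e" "0 \<le> E'" by (simp_all add: P_def Q_def E_def e_def E'_def)
  have x'X: "x' \<in> X" using projection_step(1)[OF mem(1) \<alpha>(1) x'] .
  have step_x: "merit c x' y - merit c x y \<le> - (1 / \<alpha> - curvature_x) * P\<^sup>2 + (Lf + Lg) * e * P"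
    using merit_x_step[OF mem(1) x'X mem(2,4) c projection_step(3)[OF mem(1) \<alpha>(1) x']]
    by (simp add: P_def e_def)
  \<comment> \<open>The y-step starts from \<open>(x', y)\<close>, whereas \<open>t\<close> tracks
    the minimizer at \<open>(x, y)\<close>; the shift costs \<open>L\<theta> * P\<close> and creates
    the mixed term \<open>P * Q\<close>.\<close>
  have "norm (t - \<theta>s x' y) \<le> e + norm (\<theta>s x y - \<theta>s x' y)"
    using norm_triangle_ineq[of "t - \<theta>s x y" "\<theta>s x y - \<theta>s x' y"] by (simp add: e_def)
  also have "norm (\<theta>s x y - \<theta>s x' y) \<le> L\<theta> * P"
    using \<theta>s_lipschitz[OF mem(1) x'X mem(2,2)] by (simp add: P_def norm_minus_commute)
  finally have "1 / \<gamma> * (norm (t - \<theta>s x' y) * Q) \<le> 1 / \<gamma> * ((e + L\<theta> * P) * Q)"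
    using gamma nn by (intro mult_left_mono mult_right_mono) auto
  then have step_y: "merit c x' y' - merit c x' y
      \<le> - (1 / \<beta> - curvature_y) * Q\<^sup>2 + (1 / \<gamma> * (e * Q) + L\<theta> / \<gamma> * (P * Q))"
    using merit_y_step[OF x'X mem(2,3) c \<beta>(1) y'] by (simp add: Q_def algebra_simps add_divide_distrib)
  have young: "k * (r * s) \<le> k / 2 * r\<^sup>2 + k / 2 * s\<^sup>2" if "0 \<le> k" for k r s :: real
  proof -
    have "k * (2 * r * s) \<le> k * (r\<^sup>2 + s\<^sup>2)"
      using that sum_squares_bound[of r s] by (intro mult_left_mono)
    then show ?thesis by (simp add: algebra_simps)
  qed
  have y1: "(Lf + Lg) * e * P \<le> (Lf + Lg) / 2 * e\<^sup>2 + (Lf + Lg) / 2 * P\<^sup>2"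
    using young[of "Lf + Lg" e P] nonneg by (simp add: mult.assoc)
  have y2: "1 / \<gamma> * (e * Q) \<le> 1 / (2 * \<gamma>) * e\<^sup>2 + 1 / (2 * \<gamma>) * Q\<^sup>2"
    using young[of "1 / \<gamma>" e Q] gamma by (simp add: mult.commute)
  have y3: "L\<theta> / \<gamma> * (P * Q) \<le> L\<theta> / (2 * \<gamma>) * P\<^sup>2 + L\<theta> / (2 * \<gamma>) * Q\<^sup>2"
    using young[of "L\<theta> / \<gamma>" P Q] gamma L\<theta>_nonneg by (simp add: mult.commute)
  \<comment> \<open>The new tracking error is the contracted old one plus the drift of the
    minimizer.\<close>
  have "E' \<le> e + norm (\<theta>s x y - \<theta>s x' y')"
    using norm_triangle_ineq[of "t - \<theta>s x y" "\<theta>s x y - \<theta>s x' y'"] by (simp add: e_def E'_def)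
  also have "norm (\<theta>s x y - \<theta>s x' y') \<le> L\<theta> * (P + Q)"
    using \<theta>s_lipschitz[OF mem(1) x'X mem(2,3)] by (simp add: P_def Q_def norm_minus_commute)
  finally have "E'\<^sup>2 \<le> (e + L\<theta> * (P + Q))\<^sup>2" using nn by (intro power_mono) auto
  also have "\<dots> \<le> e\<^sup>2 / \<sigma> + (L\<theta> * (P + Q))\<^sup>2 / (1 - \<sigma>)"
    by (rule square_add_le_convex_weights[OF \<sigma>(1,2)])
  also have "e\<^sup>2 / \<sigma> \<le> \<sigma> * E\<^sup>2"
  proof -
    have "e\<^sup>2 \<le> (\<sigma> * E)\<^sup>2" using \<sigma>(3) nn by (intro power_mono) (auto simp: e_def E_def)
    then have "e\<^sup>2 / \<sigma> \<le> (\<sigma> * E)\<^sup>2 / \<sigma>" using \<sigma>(1) by (intro divide_right_mono) auto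
    also have "\<dots> = \<sigma> * E\<^sup>2" using \<sigma>(1) by (simp add: power2_eq_square)
    finally show ?thesis .
  qed
  also have "(L\<theta> * (P + Q))\<^sup>2 / (1 - \<sigma>) \<le> L\<theta>\<^sup>2 * (2 * (P\<^sup>2 + Q\<^sup>2)) / (1 - \<sigma>)"
  proof (rule divide_right_mono)
    have "(P + Q)\<^sup>2 \<le> 2 * (P\<^sup>2 + Q\<^sup>2)" using sum_squares_bound[of P Q] by (simp add: power2_sum)
    then show "(L\<theta> * (P + Q))\<^sup>2 \<le> L\<theta>\<^sup>2 * (2 * (P\<^sup>2 + Q\<^sup>2))"
      unfolding power_mult_distrib by (rule mult_left_mono) simp
  qed (use \<sigma> in simp)
  also have "L\<theta>\<^sup>2 * (2 * (P\<^sup>2 + Q\<^sup>2)) / (1 - \<sigma>) = drift_const \<sigma> * (P\<^sup>2 + Q\<^sup>2)" by (simp add: drift_const_def)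
  finally have "tracking_weight \<sigma> * E'\<^sup>2 \<le> tracking_weight \<sigma> * (\<sigma> * E\<^sup>2 + drift_const \<sigma> * (P\<^sup>2 + Q\<^sup>2))"
    using constants_nonneg(1)[OF \<sigma>(2)] by (intro mult_left_mono) auto
  then have cE': "tracking_weight \<sigma> * E'\<^sup>2 \<le> tracking_weight \<sigma> * \<sigma> * E\<^sup>2 + tracking_weight \<sigma> * drift_const \<sigma> * P\<^sup>2 + tracking_weight \<sigma> * drift_const \<sigma> * Q\<^sup>2"
    by (simp add: algebra_simps)
  have "e \<le> E"
  proof -
    have "\<sigma> * E \<le> 1 * E" using \<sigma> nn by (intro mult_right_mono) auto
    then show ?thesis using \<sigma>(3) by (simp add: e_def E_def)
  qed
  then have "e\<^sup>2 \<le> E\<^sup>2" using nn by (intro power_mono) auto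
  then have eE: "((Lf + Lg) / 2 + 1 / (2 * \<gamma>)) * e\<^sup>2 \<le> ((Lf + Lg) / 2 + 1 / (2 * \<gamma>)) * E\<^sup>2"
    using nonneg gamma by (intro mult_left_mono) auto
  have "(Lf + Lg) / 2 + 1 / (2 * \<gamma>) + tracking_weight \<sigma> * \<sigma> = tracking_weight \<sigma> - 1"
  proof -
    have "tracking_weight \<sigma> * (1 - \<sigma>) = (Lf + Lg) / 2 + 1 / (2 * \<gamma>) + 1" using \<sigma> by (simp add: tracking_weight_def)
    then show ?thesis by (simp add: algebra_simps)
  qed
  then have cE: "((Lf + Lg) / 2 + 1 / (2 * \<gamma>)) * E\<^sup>2 + tracking_weight \<sigma> * \<sigma> * E\<^sup>2 = tracking_weight \<sigma> * E\<^sup>2 - E\<^sup>2"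
    by (metis distrib_right left_diff_distrib mult_1)
  have inv: "k * s\<^sup>2 \<le> 1 / r * s\<^sup>2" if "0 < r" "r < 1 / k" "1 \<le> k" for k r s :: real
    using that by (intro mult_right_mono) (auto simp: field_simps)
  have iP: "step_const_x \<sigma> * P\<^sup>2 \<le> 1 / \<alpha> * P\<^sup>2" and iQ: "step_const_y \<sigma> * Q\<^sup>2 \<le> 1 / \<beta> * Q\<^sup>2"
    using inv \<alpha> \<beta> constants_nonneg[OF \<sigma>(2)] by blast+
  have "merit c x' y' + tracking_weight \<sigma> * E'\<^sup>2 + (P\<^sup>2 + Q\<^sup>2 + E\<^sup>2) \<le> merit c x y + tracking_weight \<sigma> * E\<^sup>2"
    using step_x step_y y1 y2 y3 cE' eE cE iP iQ unfolding step_const_x_def step_const_y_def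
    by (simp only: distrib_right left_diff_distrib minus_diff_eq)
  then show ?thesis by (simp add: lyapunov_def P_def Q_def E_def E'_def)
qed

section \<open>Subgradients at the new iterate and the residual\<close>

lemma partial_subgradient_mem:
  assumes mem: "x \<in> X" "y \<in> Y"
    and sub: "\<And>w. w \<in> Y \<Longrightarrow> g (x, y) + inner \<xi> (w - y) - \<rho> / 2 * (norm (w - y))\<^sup>2 \<le> g (x, w)"
  shows "(gradient_x g x y, \<xi>) \<in> frechet_subdifferential_on (X \<times> Y) g (x, y)"
proof (rule frechet_subdifferential_onI_quadratic[where q = "2 * Lg + \<rho> / 2"])
  fix z assume "z \<in> X \<times> Y"
  then obtain u w where z: "z = (u, w)" and uw: "u \<in> X" "w \<in> Y" by auto
  define N where "N = norm ((u - x, w - y))"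
  \<comment> \<open>The path from \<open>(x, y)\<close> to \<open>(u, w)\<close> goes through
    \<open>(x, w)\<close>: \<open>sub\<close> handles the change of the second argument, smoothness
    in the first handles the rest. Moving the partial gradient from \<open>w\<close> back to
    \<open>y\<close> costs a product of the two increments, again quadratic in
    \<open>N\<close>.\<close>
  have "\<bar>g (u, w) - g (x, w) - inner (gradient_x g x w) (u - x)\<bar> \<le> Lg * (norm (u - x))\<^sup>2"
    using gderiv_quadratic_bound[OF X(2) mem(1) uw(1) gderiv_g[OF _ uw(2)], of Lg]
      gradient_x_g_lipschitz[OF _ _ uw(2,2)] nonneg by simp
  moreover have "Lg * (norm (u - x))\<^sup>2 \<le> Lg * N\<^sup>2"
    unfolding N_def using norm_prod_ge nonneg by (intro mult_left_mono) auto
  moreover have "\<bar>inner (gradient_x g x w - gradient_x g x y) (u - x)\<bar> \<le> Lg * norm (w - y) * norm (u - x)"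
    using gradient_x_g_lipschitz[OF mem(1,1) uw(2) mem(2)] by (intro abs_inner_le) simp
  moreover have "Lg * norm (w - y) * norm (u - x) \<le> Lg * N\<^sup>2"
    unfolding N_def mult.assoc mult.commute[of "norm (w - y)"]
    using norm_prod_ge nonneg by (intro mult_left_mono) auto
  moreover have "\<rho> / 2 * (norm (w - y))\<^sup>2 \<le> \<rho> / 2 * N\<^sup>2"
    unfolding N_def using norm_prod_ge nonneg by (intro mult_left_mono) auto
  moreover note sub[OF uw(2)]
  ultimately have "g (x, y) + (inner (gradient_x g x y) (u - x) + inner \<xi> (w - y))
      - (2 * (Lg * N\<^sup>2) + \<rho> / 2 * N\<^sup>2) \<le> g (u, w)"
    unfolding inner_diff_left[of "gradient_x g x w"] by linarith
  then show "g (x, y) + inner (gradient_x g x y, \<xi>) (z - (x, y))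
      - (2 * Lg + \<rho> / 2) * (norm (z - (x, y)))\<^sup>2 \<le> g z"
    by (simp add: z inner_prod_def N_def algebra_simps)
qed

text \<open>The first bracket is for the \<open>x\<close> component of the residual, the second for
  the \<open>y\<close> component.\<close>

definition residual_const where "residual_const \<alpha>_low \<beta>_low =
  (LF / clow + (Lf + Lg) + (Lf + Lg) * (1 + L\<theta>) + 1 / \<alpha>_low)
  + (LF / clow + Lf + 1 / \<beta>_low + (1 / \<gamma>) * (1 + L\<theta>))"

text \<open>The optimality conditions of the two steps give an explicit element
  \<open>(u1, u2)\<close> of the set whose distance to 0 is the residual. It consists of differences
  of gradients at old and new points and of scaled steps, all Lipschitz-bounded by the step lengths
  and the tracking error.\<close>

lemma residual_bound:
  assumes mem: "x \<in> X" "y \<in> Y" "y' \<in> Y" "t \<in> Y" and c: "clow \<le> c"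
    and e: "norm (t - \<theta>s x y) \<le> E"
    and \<alpha>: "0 < \<alpha>_low" "\<alpha>_low < \<alpha>" and \<beta>: "0 < \<beta>_low" "\<beta>_low < \<beta>"
    and x': "x' = closest_point X (x - \<alpha> *\<^sub>R dx c x y t)"
    and y': "y' \<in> prox_g_tilde Y g \<beta> x' (y - \<beta> *\<^sub>R dy c x' y t)"
  shows "residual X Y F f g \<gamma> c (x', y')
      \<le> ereal (c * (residual_const \<alpha>_low \<beta>_low * (norm (x' - x) + norm (y' - y) + E)))"
proof -
  define P Q S where "P = norm (x' - x)" and "Q = norm (y' - y)" and "S = P + Q + E"
  define s where "s = \<theta>s x' y'"
  have \<alpha>0: "0 < \<alpha>" and \<beta>0: "0 < \<beta>" and c0: "0 < c" using \<alpha> \<beta> c clow by auto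
  have x'X: "x' \<in> X" using projection_step(1)[OF mem(1) \<alpha>0 x'] .
  have sY: "s \<in> Y" using \<theta>s_minimizer(1)[OF x'X mem(3)] by (simp add: s_def)
  have E0: "0 \<le> E" using e norm_ge_zero order_trans by blast
  have nn: "0 \<le> P" "0 \<le> Q" "P \<le> S" "Q \<le> S" "P + Q \<le> S" "P + E \<le> S" "Q + E \<le> S" "0 \<le> S"
    using E0 by (simp_all add: P_def Q_def S_def)
  have "norm (s - t) \<le> norm (t - \<theta>s x y) + norm (\<theta>s x y - s)"
    using norm_triangle_ineq[of "t - \<theta>s x y" "\<theta>s x y - s"] by (simp add: norm_minus_commute)
  also have "norm (\<theta>s x y - s) \<le> L\<theta> * (P + Q)"
    using \<theta>s_lipschitz[OF mem(1) x'X mem(2,3)] by (simp add: P_def Q_def s_def norm_minus_commute)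
  also have "\<dots> \<le> L\<theta> * S" using nn L\<theta>_nonneg by (intro mult_left_mono)
  finally have st: "norm (s - t) \<le> E + L\<theta> * S" using e by simp
  \<comment> \<open>\<open>\<nu>\<close> is the normal vector produced by the projection,
    \<open>\<xi>\<close> the subgradient produced by the proximal step.\<close>
  define \<nu> where "\<nu> = - (1 / \<alpha>) *\<^sub>R (x' - x) - dx c x y t"
  define \<xi> where "\<xi> = (1 / \<beta>) *\<^sub>R (y - y') - dy c x' y t"
  define u1 where "u1 = gradient_x F x' y' + c *\<^sub>R (gradient_x f x' y' + gradient_x g x' y' - gx x' s + \<nu>)"
  define u2 where "u2 = gradient_y F x' y' + c *\<^sub>R (gradient_y f x' y' + \<xi> - (1 / \<gamma>) *\<^sub>R (y' - s))"
  have "(gradient_x g x' y', \<xi>) \<in> frechet_subdifferential_on (X \<times> Y) g (x', y')"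
  proof (rule partial_subgradient_mem[OF x'X mem(3)])
    fix w assume w: "w \<in> Y"
    have "\<beta> * g (x', y') + inner (y - \<beta> *\<^sub>R dy c x' y t - y') (w - y') - \<beta> * \<rho> / 2 * (norm (w - y'))\<^sup>2
        \<le> \<beta> * g (x', w)"
      by (rule prox_g_tilde_optimality[OF y' \<beta>0 Y(1) w weakly_convex_snd[OF x'X] nonneg(1)])
    moreover have "y - \<beta> *\<^sub>R dy c x' y t - y' = \<beta> *\<^sub>R \<xi>"
      using \<beta>0 by (simp add: \<xi>_def scaleR_diff_right)
    ultimately have "\<beta> * g (x', y') + \<beta> * inner \<xi> (w - y') - \<beta> * \<rho> / 2 * (norm (w - y'))\<^sup>2 \<le> \<beta> * g (x', w)"
      by (simp only: inner_scaleR_left)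
    then have "\<beta> * (g (x', y') + inner \<xi> (w - y') - \<rho> / 2 * (norm (w - y'))\<^sup>2) \<le> \<beta> * g (x', w)"
      by (simp add: algebra_simps)
    then show "g (x', y') + inner \<xi> (w - y') - \<rho> / 2 * (norm (w - y'))\<^sup>2 \<le> g (x', w)"
      using \<beta>0 mult_le_cancel_left_pos by blast
  qed
  moreover have "inner \<nu> (w - x') \<le> 0" if "w \<in> X" for w
    unfolding \<nu>_def using that by (rule projection_step(2)[OF mem(1) \<alpha>0 x'])
  \<comment> \<open>The second component is 0 because the constraint on \<open>y\<close> is already
    contained in \<open>\<xi>\<close>, which is a subgradient relative to \<open>Y\<close>.\<close>
  then have "(c *\<^sub>R \<nu>, 0) \<in> normal_cone (X \<times> Y) (x', y')"
    using c0 by (auto simp: normal_cone_def inner_prod_def mult_le_0_iff)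
  moreover have "(u1, u2) = gradient F (x', y') + c *\<^sub>R (gradient f (x', y') + (gradient_x g x' y', \<xi>)
      - moreau_gradient Y f g \<gamma> (x', y')) + (c *\<^sub>R \<nu>, 0)"
  proof -
    have "gradient F (x', y') = (gradient_x F x' y', gradient_y F x' y')"
      "gradient f (x', y') = (gradient_x f x' y', gradient_y f x' y')"
      using smooth_gradient_x(2) smooth_gradient_y(2) F(1) f x'X mem(3) by (metis prod.collapse)+
    then show ?thesis
      by (simp add: moreau_gradient_def Let_def u1_def u2_def s_def[symmetric] algebra_simps)
  qed
  ultimately have "residual X Y F f g \<gamma> c (x', y') \<le> ereal (dist 0 (u1, u2))"
    unfolding residual_def by (intro INF_lower) blast
  moreover have "dist 0 (u1, u2) \<le> norm u1 + norm u2" using norm_Pair_le by simp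
  moreover have "LF * r \<le> c * (LF / clow * S)" if "0 \<le> r" "r \<le> S" for r
  proof -
    have "LF * r \<le> LF * S" using that nonneg by (intro mult_left_mono)
    also have "\<dots> = clow * (LF / clow * S)" using clow by simp
    also have "\<dots> \<le> c * (LF / clow * S)" using c clow nonneg nn by (intro mult_right_mono) auto
    finally show ?thesis .
  qed
  note LF_bound = this
  have "norm u1 \<le> c * ((LF / clow + (Lf + Lg) + (Lf + Lg) * (1 + L\<theta>) + 1 / \<alpha>_low) * S)"
  proof -
    \<comment> \<open>In \<open>c *\<^sub>R \<nu>\<close> the term
      \<open>(1 / c) *\<^sub>R gradient_x F x y\<close> loses its scaling and pairs with the
      gradient of \<open>F\<close> at the new point; \<open>w\<close> collects the rest.\<close>
    define w where "w = (gx x' y' - gx x y) - (gx x' s - gx x t) - (1 / \<alpha>) *\<^sub>R (x' - x)"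
    have "u1 = (gradient_x F x' y' - gradient_x F x y) + c *\<^sub>R w"
      using c0 by (simp add: u1_def \<nu>_def w_def algebra_simps)
    then have "norm u1 \<le> norm (gradient_x F x' y' - gradient_x F x y) + norm (c *\<^sub>R w)"
      using norm_triangle_ineq by metis
    moreover have "norm (gradient_x F x' y' - gradient_x F x y) \<le> c * (LF / clow * S)"
      using smooth_gradient_x_lipschitz[OF F(1) x'X mem(1,3,2)] LF_bound[of "P + Q"] nn
      by (simp add: P_def Q_def)
    moreover have "norm w \<le> ((Lf + Lg) + (Lf + Lg) * (1 + L\<theta>) + 1 / \<alpha>_low) * S"
    proof -
      have "norm w \<le> norm (gx x' y' - gx x y) + norm (gx x' s - gx x t) + norm ((1 / \<alpha>) *\<^sub>R (x' - x))"
        unfolding w_def by (rule norm_diff_diff_le)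
      moreover have "norm (gx x' y' - gx x y) \<le> (Lf + Lg) * S"
        using gx_lipschitz[OF x'X mem(1,3,2)] mult_left_mono[OF nn(5), of "Lf + Lg"] nonneg
        by (simp add: P_def Q_def)
      moreover have "norm (gx x' s - gx x t) \<le> (Lf + Lg) * ((1 + L\<theta>) * S)"
      proof -
        have "norm (x' - x) + norm (s - t) \<le> (1 + L\<theta>) * S"
          using st nn(6) by (simp add: P_def distrib_right)
        then have "(Lf + Lg) * (norm (x' - x) + norm (s - t)) \<le> (Lf + Lg) * ((1 + L\<theta>) * S)"
          using nonneg by (intro mult_left_mono) auto
        then show ?thesis using gx_lipschitz[OF x'X mem(1) sY mem(4)] by linarith
      qed
      moreover have "norm ((1 / \<alpha>) *\<^sub>R (x' - x)) \<le> 1 / \<alpha>_low * S"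
      proof -
        have "1 / \<alpha> * P \<le> 1 / \<alpha>_low * S" using \<alpha> nn by (intro mult_mono) (auto simp: field_simps)
        then show ?thesis using \<alpha>0 by (simp add: P_def)
      qed
      ultimately have "norm w \<le> (Lf + Lg) * S + (Lf + Lg) * ((1 + L\<theta>) * S) + 1 / \<alpha>_low * S" by linarith
      then show ?thesis by (simp only: distrib_right[of _ _ S] mult.assoc)
    qed
    then have "norm (c *\<^sub>R w) \<le> c * (((Lf + Lg) + (Lf + Lg) * (1 + L\<theta>) + 1 / \<alpha>_low) * S)"
      using c0 by simp
    ultimately have "norm u1 \<le> c * (LF / clow * S) + c * (((Lf + Lg) + (Lf + Lg) * (1 + L\<theta>) + 1 / \<alpha>_low) * S)"
      by linarith
    then show ?thesis by (simp add: algebra_simps)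
  qed
  moreover have "norm u2 \<le> c * ((LF / clow + Lf + 1 / \<beta>_low + (1 / \<gamma>) * (1 + L\<theta>)) * S)"
  proof -
    define w where "w = (gradient_y f x' y' - gradient_y f x' y) - (1 / \<beta>) *\<^sub>R (y' - y)
      - (1 / \<gamma>) *\<^sub>R ((y' - y) - (s - t))"
    have "u2 = (gradient_y F x' y' - gradient_y F x' y) + c *\<^sub>R w"
      using c0 by (simp add: u2_def \<xi>_def w_def algebra_simps)
    then have "norm u2 \<le> norm (gradient_y F x' y' - gradient_y F x' y) + norm (c *\<^sub>R w)"
      using norm_triangle_ineq by metis
    moreover have "norm (gradient_y F x' y' - gradient_y F x' y) \<le> c * (LF / clow * S)"
      using smooth_gradient_y_lipschitz[OF F(1) x'X x'X mem(3,2)] LF_bound[of Q] nn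
      by (simp add: Q_def)
    moreover have "norm w \<le> (Lf + 1 / \<beta>_low + (1 / \<gamma>) * (1 + L\<theta>)) * S"
    proof -
      have "norm w \<le> norm (gradient_y f x' y' - gradient_y f x' y) + norm ((1 / \<beta>) *\<^sub>R (y' - y))
          + norm ((1 / \<gamma>) *\<^sub>R ((y' - y) - (s - t)))"
        unfolding w_def by (rule norm_diff_diff_le)
      moreover have "norm (gradient_y f x' y' - gradient_y f x' y) \<le> Lf * S"
        using smooth_gradient_y_lipschitz[OF f x'X x'X mem(3,2)] mult_left_mono[OF nn(4), of Lf] nonneg
        by (simp add: Q_def)
      moreover have "norm ((1 / \<beta>) *\<^sub>R (y' - y)) \<le> 1 / \<beta>_low * S"
      proof -
        have "1 / \<beta> * Q \<le> 1 / \<beta>_low * S" using \<beta> nn by (intro mult_mono) (auto simp: field_simps)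
        then show ?thesis using \<beta>0 by (simp add: Q_def)
      qed
      moreover have "norm ((1 / \<gamma>) *\<^sub>R ((y' - y) - (s - t))) \<le> (1 / \<gamma>) * ((1 + L\<theta>) * S)"
      proof -
        have "norm ((y' - y) - (s - t)) \<le> (1 + L\<theta>) * S"
          using norm_triangle_ineq4[of "y' - y" "s - t"] st nn(7) by (simp add: Q_def distrib_right)
        then have "1 / \<gamma> * norm ((y' - y) - (s - t)) \<le> 1 / \<gamma> * ((1 + L\<theta>) * S)"
          using gamma by (intro mult_left_mono) auto
        then show ?thesis using gamma by simp
      qed
      ultimately have "norm w \<le> Lf * S + 1 / \<beta>_low * S + (1 / \<gamma>) * ((1 + L\<theta>) * S)" by linarith
      then show ?thesis by (simp only: distrib_right[of _ _ S] mult.assoc)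
    qed
    then have "norm (c *\<^sub>R w) \<le> c * ((Lf + 1 / \<beta>_low + (1 / \<gamma>) * (1 + L\<theta>)) * S)"
      using c0 by simp
    ultimately have "norm u2 \<le> c * (LF / clow * S) + c * ((Lf + 1 / \<beta>_low + (1 / \<gamma>) * (1 + L\<theta>)) * S)"
      by linarith
    then show ?thesis by (simp add: algebra_simps)
  qed
  ultimately have "residual X Y F f g \<gamma> c (x', y') \<le> ereal (norm u1 + norm u2)"
    by (meson ereal_less_eq(3) order_trans)
  moreover have "norm u1 + norm u2 \<le> c * (residual_const \<alpha>_low \<beta>_low * S)"
    using \<open>norm u1 \<le> _\<close> \<open>norm u2 \<le> _\<close> unfolding residual_const_def distrib_right[of _ _ S] distrib_left[of c]
    by linarith
  ultimately show ?thesis unfolding S_def P_def Q_def by (meson ereal_less_eq(3) order_trans)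
qed

end

subsection \<open>Convergence rates\<close>

text \<open>Telescoping bounds the sum of the increments by \<open>V 1\<close>, and some increment
  is at most the average.\<close>

lemma exists_small_increment:
  fixes V a :: "nat \<Rightarrow> real"
  assumes step: "\<And>k. 1 \<le> k \<Longrightarrow> V (Suc k) + a k \<le> V k" and nonneg: "\<And>k. 1 \<le> k \<Longrightarrow> 0 \<le> V k"
    and K: "1 \<le> K"
  obtains j where "j \<in> {1..K}" "a j \<le> V 1 / real K"
proof -
  have sum: "V (Suc n) + (\<Sum>k=1..n. a k) \<le> V 1" for n
  proof (induction n)
    case (Suc n)
    then show ?case using step[of "Suc n"] by simp
  qed simp
  have "\<exists>j\<in>{1..K}. a j \<le> V 1 / real K"
  proof (rule ccontr)
    assume "\<not> ?thesis"
    then have "(\<Sum>k=1..K. V 1 / real K) < (\<Sum>k=1..K. a k)" using K by (intro sum_strict_mono) (auto simp: not_le)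
    then show False using sum[of K] nonneg[of "Suc K"] K by simp
  qed
  then show ?thesis using that by blast
qed

context meha_problem
begin

text \<open>The initial point is arbitrary, so feasibility and hence all estimates start at \<open>k = 1\<close>.\<close>

lemma meha_mem:
  assumes "meha X Y F f g \<gamma> c \<alpha> \<beta> \<eta> x y \<theta>" "\<And>k. 0 < \<beta> k" "\<And>k. 0 < \<eta> k" "1 \<le> k"
  shows "x k \<in> X" "y k \<in> Y" "\<theta> k \<in> Y"
proof -
  obtain j where k: "k = Suc j" using assms(4) by (cases k) auto
  show "x k \<in> X" using assms(1) closest_point_in_set X unfolding meha_def Let_def k by metis
  show "y k \<in> Y" "\<theta> k \<in> Y"
    using assms prox_g_tilde_minimizer(1) Y(2) unfolding meha_def Let_def k by metis+
qed

text \<open>A single index \<open>j\<close> serves both bounds: the increment at \<open>j\<close>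
  contains the squares of both step lengths and of the tracking error, so each of the three is at
  most \<open>r\<close>; hence the factor 3.\<close>

lemma meha_rate:
  assumes meha: "meha X Y F f g \<gamma> c \<alpha> \<beta> \<eta> x y \<theta>"
    and c: "\<And>k. clow \<le> c k" "mono c"
    and \<sigma>: "0 < \<sigma>" "\<sigma> < 1" "1 - \<eta>_low * ((1 / \<gamma> - Lf) / 2 - \<rho>) \<le> \<sigma>"
    and \<eta>: "0 < \<eta>_low" "\<And>k. \<eta>_low \<le> \<eta> k" "\<And>k. \<eta> k \<le> (1 / \<gamma> - Lf) / (Lf + 1 / \<gamma>)\<^sup>2" "\<And>k. \<eta> k * \<rho> < 1"
    and \<alpha>: "0 < \<alpha>_low" "\<And>k. \<alpha>_low < \<alpha> k" "\<And>k. \<alpha> k < 1 / step_const_x \<sigma>"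
    and \<beta>: "0 < \<beta>_low" "\<And>k. \<beta>_low < \<beta> k" "\<And>k. \<beta> k < 1 / step_const_y \<sigma>"
    and K1: "1 \<le> N"
  defines "r \<equiv> sqrt (lyapunov \<sigma> (c 1) (x 1) (y 1) (\<theta> 1) / real N)"
  obtains j where "j \<in> {1..N}" "norm (\<theta> j - \<theta>s (x j) (y j)) \<le> r"
    "residual X Y F f g \<gamma> (c j) (x (Suc j), y (Suc j)) \<le> ereal (c N * (residual_const \<alpha>_low \<beta>_low * (3 * r)))"
proof -
  have \<alpha>0: "0 < \<alpha> k" and \<beta>0: "0 < \<beta> k" and \<eta>0: "0 < \<eta> k" for k
    using \<alpha>(1) \<alpha>(2)[of k] \<beta>(1) \<beta>(2)[of k] \<eta>(1) \<eta>(2)[of k] by linarith+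
  have mem: "x k \<in> X" "y k \<in> Y" "\<theta> k \<in> Y" if "1 \<le> k" for k
    using meha_mem[OF meha \<beta>0 \<eta>0 that] by auto
  have up: "\<theta> (Suc k) \<in> prox_g_tilde Y g (\<eta> k) (x k) (\<theta> k - \<eta> k *\<^sub>R qy (x k) (y k) (\<theta> k))"
    "x (Suc k) = closest_point X (x k - \<alpha> k *\<^sub>R dx (c k) (x k) (y k) (\<theta> (Suc k)))"
    "y (Suc k) \<in> prox_g_tilde Y g (\<beta> k) (x (Suc k)) (y k - \<beta> k *\<^sub>R dy (c k) (x (Suc k)) (y k) (\<theta> (Suc k)))" for k
    using meha unfolding meha_def Let_def by blast+
  define E where "E k = norm (\<theta> k - \<theta>s (x k) (y k))" for k
  define a where "a k = (norm (x (Suc k) - x k))\<^sup>2 + (norm (y (Suc k) - y k))\<^sup>2 + (E k)\<^sup>2" for k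
  define W where "W k = lyapunov \<sigma> (c k) (x k) (y k) (\<theta> k)" for k
  \<comment> \<open>The lower bound on the stepsizes makes the contraction factor uniform in
    \<open>k\<close>.\<close>
  have contr: "norm (\<theta> (Suc k) - \<theta>s (x k) (y k)) \<le> \<sigma> * E k" if "1 \<le> k" for k
  proof -
    have "norm (\<theta> (Suc k) - \<theta>s (x k) (y k)) \<le> (1 - \<eta> k * ((1 / \<gamma> - Lf) / 2 - \<rho>)) * E k"
      unfolding E_def using theta_contraction[OF mem[OF that] \<eta>0 \<eta>(3,4) up(1)] .
    also have "\<dots> \<le> \<sigma> * E k"
    proof (rule mult_right_mono)
      have "\<eta>_low * ((1 / \<gamma> - Lf) / 2 - \<rho>) \<le> \<eta> k * ((1 / \<gamma> - Lf) / 2 - \<rho>)"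
        using \<eta>(2) gamma(2) by (intro mult_right_mono) auto
      then show "1 - \<eta> k * ((1 / \<gamma> - Lf) / 2 - \<rho>) \<le> \<sigma>" using \<sigma>(3) by linarith
    qed (simp add: E_def)
    finally show ?thesis .
  qed
  have c0: "0 < c k" for k using c(1)[of k] clow by linarith
  have "W (Suc k) + a k \<le> W k" if "1 \<le> k" for k
  proof -
    have "Suc k \<ge> 1" by simp
    have "lyapunov \<sigma> (c k) (x (Suc k)) (y (Suc k)) (\<theta> (Suc k)) + a k \<le> W k"
      unfolding W_def a_def E_def
      by (rule lyapunov_step[OF mem(1,2)[OF that] mem(2,3)[OF \<open>Suc k \<ge> 1\<close>] c(1) \<sigma>(1,2)
            contr[OF that, unfolded E_def] \<alpha>0 \<alpha>(3) \<beta>0 \<beta>(3) up(2,3)])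
    \<comment> \<open>The one-step estimate keeps \<open>c k\<close>; passing to
      \<open>c (Suc k)\<close> only lowers the merit function.\<close>
    moreover have "W (Suc k) \<le> lyapunov \<sigma> (c k) (x (Suc k)) (y (Suc k)) (\<theta> (Suc k))"
      unfolding W_def lyapunov_def
      using merit_antimono[OF mem(1,2)[OF \<open>Suc k \<ge> 1\<close>] c0 monoD[OF c(2)], of k "Suc k"] by simp
    ultimately show ?thesis by linarith
  qed
  moreover have "0 \<le> W k" if "1 \<le> k" for k
    using merit_nonneg[OF mem(1,2)[OF that] c0] constants_nonneg(1)[OF \<sigma>(2)] by (simp add: W_def lyapunov_def)
  ultimately obtain j where j: "j \<in> {1..N}" "a j \<le> W 1 / real N"
    using exists_small_increment[of W a N] K1 by blast
  have le_r: "s \<le> r" if "s\<^sup>2 \<le> a j" for s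
    unfolding r_def using that j(2) real_le_rsqrt by (simp add: W_def)
  have j1: "1 \<le> j" and Sj1: "1 \<le> Suc j" using j by auto
  have PQE: "norm (x (Suc j) - x j) \<le> r" "norm (y (Suc j) - y j) \<le> r" "E j \<le> r"
    by (rule le_r, simp add: a_def)+
  have "norm (\<theta> (Suc j) - \<theta>s (x j) (y j)) \<le> E j"
  proof -
    have "\<sigma> * E j \<le> 1 * E j" using \<sigma> by (intro mult_right_mono) (auto simp: E_def)
    then show ?thesis using contr[OF j1] by linarith
  qed
  from residual_bound[OF mem(1,2)[OF j1] mem(2,3)[OF Sj1] c(1) this \<alpha>(1,2) \<beta>(1,2) up(2,3)]
  have "residual X Y F f g \<gamma> (c j) (x (Suc j), y (Suc j))
      \<le> ereal (c j * (residual_const \<alpha>_low \<beta>_low * (norm (x (Suc j) - x j) + norm (y (Suc j) - y j) + E j)))" .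
  also have "\<dots> \<le> ereal (c N * (residual_const \<alpha>_low \<beta>_low * (3 * r)))"
  proof -
    have "0 \<le> residual_const \<alpha>_low \<beta>_low"
      unfolding residual_const_def using nonneg clow L\<theta>_nonneg gamma \<alpha>(1) \<beta>(1) by (intro add_nonneg_nonneg) auto
    moreover have "c j \<le> c N" using monoD[OF c(2)] j by auto
    ultimately show ?thesis using PQE c0[of N]
      unfolding ereal_less_eq(3) by (intro mult_mono mult_left_mono mult_nonneg_nonneg) (auto simp: E_def)
  qed
  finally show ?thesis using that j(1) PQE(3) by (simp add: E_def)
qed

end

section \<open>Stepsize bounds and the rates for polynomially growing penalties\<close>

theorem theorem3p4:
  fixes X :: "(real^'n) set" and Y :: "(real^'m) set"
    and F f g :: "(real^'n) \<times> (real^'m) \<Rightarrow> real"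
    and L\<^sub>F L\<^sub>f \<rho>\<^sub>f\<^sub>2 \<rho>\<^sub>g\<^sub>1 \<rho>\<^sub>g\<^sub>2 L\<^sub>g \<gamma> c_low p \<eta>_low :: real
    and c \<eta> :: "nat \<Rightarrow> real"
  assumes X: "closed X" "convex X" "X \<noteq> {}"
    and Y: "closed Y" "convex Y" "Y \<noteq> {}"
    and F: "bdd_below (F ` (X \<times> Y))" "smooth_on_with L\<^sub>F (X \<times> Y) F"
    and f: "smooth_on_with L\<^sub>f (X \<times> Y) f"
    and rho_f: "\<rho>\<^sub>f\<^sub>2 = L\<^sub>f"
    and g: "g_assumption X Y g \<rho>\<^sub>g\<^sub>1 \<rho>\<^sub>g\<^sub>2 L\<^sub>g"
    and gamma: "0 < \<gamma>" "ereal \<gamma> < 1 / ereal (2 * \<rho>\<^sub>f\<^sub>2 + 2 * \<rho>\<^sub>g\<^sub>2)"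
    and minimizer_exists: "\<forall>x\<in>X. \<forall>y\<in>Y. \<exists>t.
          is_arg_min (moreau_objective (\<lambda>z. f z + g z) \<gamma> x y) (\<lambda>t. t \<in> Y) t"
    and c: "0 < c_low" "0 \<le> p" "p < 1 / 2" "\<forall>k. c k = c_low * real (k + 1) powr p"
    and eta: "0 < \<eta>_low"
      "\<forall>k. \<eta>_low \<le> \<eta> k \<and> \<eta> k \<le> (1 / \<gamma> - \<rho>\<^sub>f\<^sub>2) / (L\<^sub>f + 1 / \<gamma>)\<^sup>2 \<and> ereal (\<eta> k) < 1 / ereal \<rho>\<^sub>g\<^sub>2"
  shows "\<exists>c\<^sub>\<alpha>>0. \<exists>c\<^sub>\<beta>>0. \<forall>\<alpha>_low>0. \<forall>\<beta>_low>0. \<forall>\<alpha> \<beta> x y \<theta>.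
     (\<forall>k. \<alpha>_low < \<alpha> k \<and> \<alpha> k < c\<^sub>\<alpha>) \<and> (\<forall>k. \<beta>_low < \<beta> k \<and> \<beta> k < c\<^sub>\<beta>) \<and>
     meha X Y F f g \<gamma> c \<alpha> \<beta> \<eta> x y \<theta> \<longrightarrow>
       (\<lambda>K. MIN k\<in>{0..K}. norm (\<theta> k - moreau_minimizer Y (\<lambda>z. f z + g z) \<gamma> (x k) (y k)))
         \<in> O(\<lambda>K. 1 / real K powr (1 / 2)) \<and>
       (\<exists>C. \<forall>\<^sub>F K in sequentially.
          (MIN k\<in>{0..K}. residual X Y F f g \<gamma> (c k) (x (Suc k), y (Suc k)))
            \<le> ereal (C * (1 / real K powr ((1 - 2 * p) / 2)))) \<and>
       (0 < p \<and> bdd_above (range (\<lambda>k. penalty_fun Y F (\<lambda>z. f z + g z) \<gamma> (c k) (x k) (y k))) \<longrightarrow>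
          (\<lambda>K. f (x K, y K) + g (x K, y K) - moreau Y (\<lambda>z. f z + g z) \<gamma> (x K) (y K))
            \<in> O(\<lambda>K. 1 / real K powr p))"
proof -
  have reg: "regular_constants X Y g \<rho>\<^sub>g\<^sub>1 \<rho>\<^sub>g\<^sub>2 L\<^sub>g" using g by (simp add: g_assumption_def)
  then have \<rho>0: "0 \<le> \<rho>\<^sub>g\<^sub>2" by (simp add: regular_constants_def)
  have Lf0: "0 \<le> L\<^sub>f" using f lipschitz_on_nonneg by (auto simp: smooth_on_with_def)
  \<comment> \<open>The bounds are stated in the extended reals, where
    \<open>1 / 0 = \<infinity>\<close>, so a vanishing constant imposes no bound; the product form
    covers that case as well.\<close>
  have ereal_recip: "r * s < 1" if "ereal r < 1 / ereal s" "0 \<le> s" for r s :: real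
    using that by (cases "s = 0") (auto simp: one_ereal_def field_simps)
  have "(2 * L\<^sub>f + 2 * \<rho>\<^sub>g\<^sub>2) * \<gamma> < 1"
    using ereal_recip[OF gamma(2)] rho_f Lf0 \<rho>0 by (simp add: mult.commute)
  moreover have "(L\<^sub>f + 2 * \<rho>\<^sub>g\<^sub>2) * \<gamma> \<le> (2 * L\<^sub>f + 2 * \<rho>\<^sub>g\<^sub>2) * \<gamma>"
    using gamma(1) Lf0 by (intro mult_right_mono) auto
  ultimately have "(L\<^sub>f + 2 * \<rho>\<^sub>g\<^sub>2) * \<gamma> < 1" by (rule order.strict_trans1[rotated])
  then have \<gamma>2: "L\<^sub>f + 2 * \<rho>\<^sub>g\<^sub>2 < 1 / \<gamma>" using gamma(1) by (simp add: pos_less_divide_eq)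
  obtain Flow where Flow: "\<And>z. z \<in> X \<times> Y \<Longrightarrow> Flow \<le> F z"
    using F(1) by (auto simp: bdd_below_def)
  interpret meha_problem X Y F f g L\<^sub>F L\<^sub>f \<rho>\<^sub>g\<^sub>1 \<rho>\<^sub>g\<^sub>2 L\<^sub>g \<gamma> Flow c_low
    by unfold_locales
      (rule X Y F(2) f reg gamma(1) \<gamma>2 Flow c(1) | blast intro: minimizer_exists[rule_format])+
  define \<delta> where "\<delta> = (1 / \<gamma> - L\<^sub>f) / 2 - \<rho>\<^sub>g\<^sub>2"
  \<comment> \<open>The maximum with \<open>1 / 2\<close> keeps \<open>\<sigma>\<close> positive,
    since the weighted square inequality divides by it.\<close>
  define \<sigma> where "\<sigma> = max (1 / 2) (1 - \<eta>_low * \<delta>)"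
  have "0 < \<delta>" using \<gamma>2 by (simp add: \<delta>_def)
  then have \<sigma>: "0 < \<sigma>" "\<sigma> < 1" "1 - \<eta>_low * \<delta> \<le> \<sigma>" using eta(1) by (auto simp: \<sigma>_def)
  have c_ge: "c_low \<le> c k" for k
    using c ge_one_powr_ge_zero[of "real (k + 1)" p] mult_left_mono[of 1 "real (k + 1) powr p" c_low] by simp
  have c_mono: "mono c"
    using c by (intro monoI) (simp add: mult_left_mono powr_mono2)
  have \<eta>: "\<eta>_low \<le> \<eta> k" "\<eta> k \<le> (1 / \<gamma> - L\<^sub>f) / (L\<^sub>f + 1 / \<gamma>)\<^sup>2" "\<eta> k * \<rho>\<^sub>g\<^sub>2 < 1" for k
    using eta(2) rho_f ereal_recip \<rho>0 by auto
  have \<eta>0: "0 < \<eta> k" for k using eta(1) \<eta>(1)[of k] by linarith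
  show ?thesis
  \<comment> \<open>The witnesses depend only on the problem data, \<open>c_low\<close> and
    \<open>\<eta>_low\<close>, hence are fixed before the stepsizes and the run.\<close>
  proof (rule exI[of _ "1 / step_const_x \<sigma>"], rule conjI, goal_cases)
    case 1
    then show ?case using constants_nonneg(3)[OF \<sigma>(2)] by simp
  next
    case 2
    show ?case
    proof (rule exI[of _ "1 / step_const_y \<sigma>"], rule conjI, goal_cases)
      case 1
      then show ?case using constants_nonneg(4)[OF \<sigma>(2)] by simp
    next
      case 2
      show ?case
      proof (intro allI impI, elim conjE)
        fix \<alpha>_low \<beta>_low :: real and \<alpha> \<beta> x y \<theta>
        assume low: "0 < \<alpha>_low" "0 < \<beta>_low"
          and \<alpha>: "\<forall>k. \<alpha>_low < \<alpha> k \<and> \<alpha> k < 1 / step_const_x \<sigma>" and \<beta>: "\<forall>k. \<beta>_low < \<beta> k \<and> \<beta> k < 1 / step_const_y \<sigma>"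
          and meha: "meha X Y F f g \<gamma> c \<alpha> \<beta> \<eta> x y \<theta>"
        have \<beta>0: "0 < \<beta> k" for k using low(2) \<beta> less_trans by blast
        define V1 where "V1 = lyapunov \<sigma> (c 1) (x 1) (y 1) (\<theta> 1)"
        define Q where "Q = residual_const \<alpha>_low \<beta>_low"
        define E where "E k = norm (\<theta> k - \<theta>s (x k) (y k))" for k
        define R where "R k = residual X Y F f g \<gamma> (c k) (x (Suc k), y (Suc k))" for k
        \<comment> \<open>The index found lies in \<open>{1..N}\<close>; admitting 0 can only lower
          the minimum.\<close>
        have rate: "\<exists>j\<in>{0..N}. E j \<le> sqrt (V1 / real N) \<and> R j \<le> ereal (c N * (Q * (3 * sqrt (V1 / real N))))"
          if N: "1 \<le> N" for N
        proof -
          have \<alpha>': "\<alpha>_low < \<alpha> k" "\<alpha> k < 1 / step_const_x \<sigma>" and \<beta>': "\<beta>_low < \<beta> k" "\<beta> k < 1 / step_const_y \<sigma>" for k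
            using \<alpha> \<beta> by auto
          obtain j where "j \<in> {1..N}" "E j \<le> sqrt (V1 / real N)" "R j \<le> ereal (c N * (Q * (3 * sqrt (V1 / real N))))"
            unfolding V1_def Q_def E_def R_def
            by (rule meha_rate[OF meha c_ge c_mono \<sigma>(1,2) \<sigma>(3)[unfolded \<delta>_def] eta(1) \<eta> low(1) \<alpha>' low(2) \<beta>' N])
          then show ?thesis by auto
        qed
        have "(\<lambda>N. MIN k\<in>{0..N}. E k) \<in> O(\<lambda>N. 1 / real N powr (1 / 2))"
        proof (rule bigoI[where c = "sqrt V1"], rule eventually_sequentiallyI[of 1])
          fix N :: nat assume N: "1 \<le> N"
          obtain j where j: "j \<in> {0..N}" "E j \<le> sqrt (V1 / real N)" using rate[OF N] by blast
          have "(MIN k\<in>{0..N}. E k) \<le> E j" using j(1) by (intro Min_le) auto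
          moreover have "0 \<le> (MIN k\<in>{0..N}. E k)" by (subst Min_ge_iff) (auto simp: E_def)
          ultimately show "norm (MIN k\<in>{0..N}. E k) \<le> sqrt V1 * norm (1 / real N powr (1 / 2))"
            using j(2) by (simp add: powr_half_sqrt real_sqrt_divide)
        qed
        moreover have "\<forall>\<^sub>F N in sequentially. (MIN k\<in>{0..N}. R k)
          \<le> ereal (c_low * 2 powr p * Q * 3 * sqrt V1 * (1 / real N powr ((1 - 2 * p) / 2)))"
        proof (rule eventually_sequentiallyI[of 1])
          fix N :: nat assume N: "1 \<le> N"
          obtain j where j: "j \<in> {0..N}" "R j \<le> ereal (c N * (Q * (3 * sqrt (V1 / real N))))"
            using rate[OF N] by blast
          have "(MIN k\<in>{0..N}. R k) \<le> R j" using j(1) by (intro Min_le) auto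
          also note j(2)
          also have "ereal (c N * (Q * (3 * sqrt (V1 / real N))))
            \<le> ereal (c_low * 2 powr p * Q * 3 * sqrt V1 * (1 / real N powr ((1 - 2 * p) / 2)))"
          proof -
            have "0 \<le> Q" unfolding Q_def residual_const_def
              using nonneg clow L\<theta>_nonneg gamma low by (intro add_nonneg_nonneg) auto
            moreover have "0 \<le> V1"
              using merit_nonneg[of "x 1" "y 1" "c 1"] meha_mem[OF meha \<beta>0 \<eta>0, of 1] c_ge[of 1] c(1)
                constants_nonneg(1)[OF \<sigma>(2)] by (simp add: V1_def lyapunov_def)
            \<comment> \<open>Uses \<open>N + 1 \<le> 2 * N\<close>, valid from \<open>N = 1\<close>
              on.\<close>
            moreover have "c N \<le> c_low * (2 powr p * real N powr p)"
            proof -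
              have "real (N + 1) powr p \<le> (2 * real N) powr p" using N c(2) by (intro powr_mono2) auto
              then show ?thesis using c(1,4) by (simp add: powr_mult)
            qed
            ultimately have "c N * (Q * (3 * sqrt (V1 / real N)))
              \<le> c_low * (2 powr p * real N powr p) * (Q * (3 * sqrt (V1 / real N)))"
              by (intro mult_right_mono) auto
            also have "\<dots> = c_low * 2 powr p * Q * 3 * sqrt V1 * (real N powr p / real N powr (1 / 2))"
              by (simp add: powr_half_sqrt real_sqrt_divide)
            also have "real N powr p / real N powr (1 / 2) = 1 / real N powr ((1 - 2 * p) / 2)"
              by (simp add: diff_divide_distrib flip: powr_diff powr_minus_divide)
            finally show ?thesis by simp
          qed
          finally show "(MIN k\<in>{0..N}. R k)
            \<le> ereal (c_low * 2 powr p * Q * 3 * sqrt V1 * (1 / real N powr ((1 - 2 * p) / 2)))" .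
        qed
        then have "\<exists>C. \<forall>\<^sub>F N in sequentially. (MIN k\<in>{0..N}. R k)
          \<le> ereal (C * (1 / real N powr ((1 - 2 * p) / 2)))" by blast
        moreover have "(\<lambda>N. \<phi> (x N, y N) - v (x N) (y N)) \<in> O(\<lambda>N. 1 / real N powr p)"
          if bdd: "bdd_above (range (\<lambda>k. penalty_fun Y F \<phi> \<gamma> (c k) (x k) (y k)))"
        proof -
          obtain B where B: "\<And>k. penalty_fun Y F \<phi> \<gamma> (c k) (x k) (y k) \<le> B"
            using bdd by (auto simp: bdd_above_def)
          show ?thesis
          proof (rule bigoI[where c = "(B - Flow) / c_low"], rule eventually_sequentiallyI[of 1])
            fix N :: nat assume N: "1 \<le> N"
            have mem: "x N \<in> X" "y N \<in> Y" using meha_mem[OF meha \<beta>0 \<eta>0 N] by auto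
            define d where "d = \<phi> (x N, y N) - v (x N) (y N)"
            have d0: "0 \<le> d" using moreau_le_\<phi>[OF mem] by (simp add: d_def)
            \<comment> \<open>An upper bound on the penalty function and a lower bound on
              \<open>F\<close> bound \<open>c N * d\<close>; dividing by the growth of
              \<open>c N\<close> gives the rate.\<close>
            have "c_low * real N powr p * d \<le> c N * d"
              using c d0 by (intro mult_right_mono) (auto intro!: powr_mono2)
            also have "\<dots> \<le> B - Flow"
              using B[of N] Flow[of "(x N, y N)"] mem by (simp add: penalty_fun_def d_def)
            finally have "d \<le> (B - Flow) / c_low * (1 / real N powr p)"
              using c(1) N by (simp add: field_simps)
            then show "norm (\<phi> (x N, y N) - v (x N) (y N)) \<le> (B - Flow) / c_low * norm (1 / real N powr p)"
              using d0 by (simp add: d_def)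
          qed
        qed
        ultimately show "(\<lambda>K. MIN k\<in>{0..K}. norm (\<theta> k - \<theta>s (x k) (y k))) \<in> O(\<lambda>K. 1 / real K powr (1 / 2)) \<and>
          (\<exists>C. \<forall>\<^sub>F K in sequentially. (MIN k\<in>{0..K}. residual X Y F f g \<gamma> (c k) (x (Suc k), y (Suc k)))
            \<le> ereal (C * (1 / real K powr ((1 - 2 * p) / 2)))) \<and>
          (0 < p \<and> bdd_above (range (\<lambda>k. penalty_fun Y F \<phi> \<gamma> (c k) (x k) (y k))) \<longrightarrow>
            (\<lambda>K. \<phi> (x K, y K) - v (x K) (y K)) \<in> O(\<lambda>K. 1 / real K powr p))"
          unfolding E_def R_def by blast
      qed
    qed
  qed
qed

end
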